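(* Let $\Theta\subset\mathbb R^+=(0,\infty)$ be compact, let $G_0$ be a probability measure on $\Theta$, and let $(\alpha_n)_{n\ge1}\subset(0,1)$ satisfy $\sum_{n\ge1}\alpha_n=+\infty$ and $\sum_{n\ge1}\alpha_n^2<+\infty$. Let $(Y_n)_{n\ge1}$ be an $\mathbb N_0$-valued sequence on a probability space $(\Omega,\mathcal F,\mathbb P)$, with natural filtration $(\mathcal G_n)_{n\ge0}$, whose law is specified by the learning model with learning rate $(\alpha_n)$ and initial guess $G_0$ (see context), and let $(G_n)_{n\ge1}$ be the associated random probability measures on $\Theta$. Then, as $n\to+\infty$, $G_n$ converges weakly $\mathbb P$-a.s. to a random probability distribution $\tilde G$ on $\Theta$ such that, with $p_{\tilde G}(y)=\int_\Theta \mathrm{Poisson}(y\mid\theta)\,\tilde G(d\theta)$, it holds $\mathbb P$-a.s. that $$p_{\tilde G}(y)=\lim_{n\to\infty}\frac1n\sum_{k=1}^n I(Y_k=y)\qquad\text{and}\qquad \mathbb P(Y_{n+k}=y\mid\mathcal G_n)=E\big(p_{\tilde G}(y)\mid\mathcal G_n\big)$$ for every $n\ge0$, $k\ge1$ and $y\in\mathbb N_0$. In particular, $\mathbb P(Y_n=y)=\int p_{\tilde G}(y)\,d\mathbb P$.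
   Context: $\mathbb N_0=\{0,1,2,\dots\}$ and $\mathrm{Poisson}(y\mid\theta)=e^{-\theta}\theta^y/y!$. $\mathcal G_n=\sigma(Y_1,\dots,Y_n)$, with $\mathcal G_0$ trivial. Learning model: for each $n\ge0$, $$\mathbb P(Y_{n+1}=y\mid\mathcal G_n)=p_{G_n}(y):=\int_\Theta\mathrm{Poisson}(y\mid\theta)\,G_n(d\theta),\qquad y\in\mathbb N_0,$$ where the random measures $G_n$ are defined recursively from $G_0$ by Newton's algorithm $$G_{n+1}(d\theta)=(1-\alpha_{n+1})G_n(d\theta)+\alpha_{n+1}\frac{\mathrm{Poisson}(Y_{n+1}\mid\theta)\,G_n(d\theta)}{\int_\Theta\mathrm{Poisson}(Y_{n+1}\mid\vartheta)\,G_n(d\vartheta)}.$$ *)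

theory Defs
  imports "HOL-Probability.Probability"
begin

text \<open>
  A probability measure on \<open>\<Theta>\<close> is an element of
  \<open>space (prob_algebra (restrict_space borel \<Theta>))\<close>, a random probability measure on \<open>\<Theta>\<close> is a
  measurable map into \<open>prob_algebra (restrict_space borel \<Theta>)\<close>.  The library's \<open>poisson_pmf \<theta>\<close>
  is specified for \<open>\<theta> > 0\<close> only, which suffices since \<open>\<Theta> \<subseteq> {0<..}\<close>.
\<close>

definition poisson_mixture :: "real measure \<Rightarrow> nat \<Rightarrow> real" where
  "poisson_mixture G y = (\<integral>\<theta>. pmf (poisson_pmf \<theta>) y \<partial>G)"

text \<open>
  Both summands of Newton's update are absolutely continuous with respect to \<open>G\<close>, so their sum
  is written as one density; see \<open>measure_newton_update\<close> below.
\<close>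

definition newton_update :: "real \<Rightarrow> nat \<Rightarrow> real measure \<Rightarrow> real measure" where
  "newton_update a y G = density G
     (\<lambda>\<theta>. ennreal ((1 - a) + a * (pmf (poisson_pmf \<theta>) y / poisson_mixture G y)))"

text \<open>The sequences \<open>\<alpha>\<close> and \<open>y\<close> are indexed from 1; their values at 0 are never used.\<close>

primrec newton :: "real measure \<Rightarrow> (nat \<Rightarrow> real) \<Rightarrow> (nat \<Rightarrow> nat) \<Rightarrow> nat \<Rightarrow> real measure" where
  "newton G0 \<alpha> y 0 = G0"
| "newton G0 \<alpha> y (Suc n) = newton_update (\<alpha> (Suc n)) (y (Suc n)) (newton G0 \<alpha> y n)"

text \<open>The \<open>\<sigma>\<close>-algebra generated by \<open>Y 1, \<dots>, Y n\<close>; it is \<open>{{}, space M}\<close> for \<open>n = 0\<close>.\<close>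

definition nat_filtration :: "'a measure \<Rightarrow> (nat \<Rightarrow> 'a \<Rightarrow> nat) \<Rightarrow> nat \<Rightarrow> 'a measure" where
  "nat_filtration M Y n =
     sigma (space M) (\<Union>k\<in>{1..n}. {Y k -` A \<inter> space M | A. A \<in> sets (count_space UNIV)})"

text \<open>
  Weak convergence of measures on the subspace \<open>S\<close>, by bounded continuous test functions on \<open>S\<close>.
  The library's \<open>weak_conv_m\<close> compares distribution functions of measures on the whole line;
  \<open>weak_conv_on_iff_weak_conv_m\<close> below relates the two.
\<close>

definition weak_conv_on :: "real set \<Rightarrow> (nat \<Rightarrow> real measure) \<Rightarrow> real measure \<Rightarrow> bool" where
  "weak_conv_on S \<mu> \<nu> \<longleftrightarrow>
     (\<forall>f :: real \<Rightarrow> real. continuous_on S f \<and> bounded (f ` S) \<longrightarrow>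
        (\<lambda>n. \<integral>x. f x \<partial>\<mu> n) \<longlonglongrightarrow> (\<integral>x. f x \<partial>\<nu>))"

lemma measurable_poisson:
  assumes "\<Theta> \<subseteq> {0<..}" and "sets G = sets (restrict_space borel \<Theta>)"
  shows "(\<lambda>\<theta>. pmf (poisson_pmf \<theta>) y) \<in> borel_measurable G"
proof -
  have sp: "space G = \<Theta>"
    using sets_eq_imp_space_eq[OF assms(2)] by (simp add: space_restrict_space)
  have "(\<lambda>\<theta>::real. \<theta> ^ y / fact y * exp (- \<theta>)) \<in> borel_measurable (restrict_space borel \<Theta>)"
    by (intro measurable_restrict_space1) measurable
  then have "(\<lambda>\<theta>::real. \<theta> ^ y / fact y * exp (- \<theta>)) \<in> borel_measurable G"
    by (simp cong: measurable_cong_sets add: assms(2))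
  then show ?thesis
    by (rule measurable_cong[THEN iffD1, rotated]) (use assms(1) sp in auto)
qed

lemma measure_newton_update:
  assumes "\<Theta> \<subseteq> {0<..}" and "G \<in> space (prob_algebra (restrict_space borel \<Theta>))"
    and "0 < a" "a < 1" and A: "A \<in> sets G"
  shows "measure (newton_update a y G) A =
    (1 - a) * measure G A
      + a * ((\<integral>\<theta>\<in>A. pmf (poisson_pmf \<theta>) y \<partial>G) / (\<integral>\<theta>. pmf (poisson_pmf \<theta>) y \<partial>G))"
proof -
  have sG: "sets G = sets (restrict_space borel \<Theta>)" and "prob_space G"
    using assms(2) by (auto simp: space_prob_algebra)
  interpret prob_space G by fact
  note [measurable] = measurable_poisson[OF assms(1) sG, of y] A
  let ?c = "poisson_mixture G y"
  let ?d = "\<lambda>\<theta>. (1 - a) + a * (pmf (poisson_pmf \<theta>) y / ?c)"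
  have c: "0 \<le> ?c"
    unfolding poisson_mixture_def by (intro Bochner_Integration.integral_nonneg) auto
  have d: "0 \<le> ?d \<theta>" for \<theta>
    using c assms(3,4) by (intro add_nonneg_nonneg mult_nonneg_nonneg divide_nonneg_nonneg) auto
  have int: "integrable G (\<lambda>\<theta>. pmf (poisson_pmf \<theta>) y)"
    by (rule integrable_const_bound[where B = 1]) (auto simp: pmf_le_1)
  have intA: "integrable G (\<lambda>\<theta>. indicator A \<theta> * pmf (poisson_pmf \<theta>) y)"
    by (rule integrable_const_bound[where B = 1])
       (auto simp: pmf_le_1 indicator_def)
  have "measure (newton_update a y G) A
      = enn2real (\<integral>\<^sup>+\<theta>. ennreal (?d \<theta>) * indicator A \<theta> \<partial>G)"
    unfolding newton_update_def measure_def by (subst emeasure_density) auto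
  also have "(\<integral>\<^sup>+\<theta>. ennreal (?d \<theta>) * indicator A \<theta> \<partial>G)
      = (\<integral>\<^sup>+\<theta>. ennreal (indicator A \<theta> * ?d \<theta>) \<partial>G)"
    by (intro nn_integral_cong) (auto simp: indicator_def)
  also have "enn2real \<dots> = (\<integral>\<theta>. indicator A \<theta> * ?d \<theta> \<partial>G)"
    by (rule integral_eq_nn_integral[symmetric])
       (measurable, intro AE_I2 mult_nonneg_nonneg d indicator_pos_le)
  also have "\<dots> = (\<integral>\<theta>. (1 - a) * indicator A \<theta>
      + a / ?c * (indicator A \<theta> * pmf (poisson_pmf \<theta>) y) \<partial>G)"
    by (intro Bochner_Integration.integral_cong) (auto simp: algebra_simps)
  also have "\<dots> = (1 - a) * measure G A + a / ?c * (\<integral>\<theta>. indicator A \<theta> * pmf (poisson_pmf \<theta>) y \<partial>G)"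
    using intA by (subst Bochner_Integration.integral_add) (auto simp: emeasure_eq_measure)
  finally show ?thesis
    by (simp add: poisson_mixture_def set_lebesgue_integral_def)
qed

lemma weak_conv_on_iff_weak_conv_m:
  assumes S: "closed S"
    and \<mu>: "\<And>n. \<mu> n \<in> space (prob_algebra (restrict_space borel S))"
    and \<nu>: "\<nu> \<in> space (prob_algebra (restrict_space borel S))"
  shows "weak_conv_on S \<mu> \<nu> \<longleftrightarrow>
    weak_conv_m (\<lambda>n. distr (\<mu> n) borel (\<lambda>x. x)) (distr \<nu> borel (\<lambda>x. x))"
proof -
  have id: "(\<lambda>x. x) \<in> borel_measurable G" "space G = S" "prob_space G"
    if "G \<in> space (prob_algebra (restrict_space borel S))" for G
  proof -
    have s: "sets G = sets (restrict_space borel S)" "prob_space G"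
      using that by (auto simp: space_prob_algebra)
    show "prob_space G" by fact
    show "space G = S"
      using sets_eq_imp_space_eq[OF s(1)] by (simp add: space_restrict_space)
    show "(\<lambda>x. x) \<in> borel_measurable G"
      unfolding measurable_cong_sets[OF s(1) refl] by (intro measurable_restrict_space1) auto
  qed
  have rd: "real_distribution (distr G borel (\<lambda>x. x))"
    if "G \<in> space (prob_algebra (restrict_space borel S))" for G
    using id[OF that] by (intro real_distribution.intro prob_space.prob_space_distr)
      (auto intro: real_distribution_axioms.intro)
  have int: "(\<integral>x. f x \<partial>distr G borel (\<lambda>x. x)) = (\<integral>x. f x \<partial>G)"
    if "G \<in> space (prob_algebra (restrict_space borel S))" "continuous_on UNIV f"
    for G and f :: "real \<Rightarrow> real"
    using id[OF that(1)] borel_measurable_continuous_onI[OF that(2)] by (subst integral_distr) auto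
  show ?thesis
  proof
    assume wc: "weak_conv_on S \<mu> \<nu>"
    show "weak_conv_m (\<lambda>n. distr (\<mu> n) borel (\<lambda>x. x)) (distr \<nu> borel (\<lambda>x. x))"
    proof (rule integral_bdd_continuous_conv_imp_weak_conv[OF rd[OF \<mu>] rd[OF \<nu>]])
      fix f :: "real \<Rightarrow> real"
      assume f: "\<And>x. isCont f x" "\<And>x. \<bar>f x\<bar> \<le> 1"
      have c: "continuous_on UNIV f"
        using f(1) by (simp add: continuous_on_eq_continuous_at)
      have "bounded (f ` S)"
        using f(2) by (auto simp: bounded_iff)
      then show "(\<lambda>n. \<integral>x. f x \<partial>distr (\<mu> n) borel (\<lambda>x. x)) \<longlonglongrightarrow> (\<integral>x. f x \<partial>distr \<nu> borel (\<lambda>x. x))"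
        using wc continuous_on_subset[OF c] by (simp add: int \<mu> \<nu> c weak_conv_on_def)
    qed
  next
    assume wc: "weak_conv_m (\<lambda>n. distr (\<mu> n) borel (\<lambda>x. x)) (distr \<nu> borel (\<lambda>x. x))"
    show "weak_conv_on S \<mu> \<nu>"
      unfolding weak_conv_on_def
    proof (intro allI impI, elim conjE)
      fix f :: "real \<Rightarrow> real"
      assume f: "continuous_on S f" "bounded (f ` S)"
      obtain B where B: "0 \<le> B" "\<And>x. x \<in> S \<Longrightarrow> norm (f x) \<le> B"
        using f(2) unfolding bounded_pos by (auto intro: less_imp_le)
      obtain g where g: "continuous_on UNIV g" "\<And>x. x \<in> S \<Longrightarrow> g x = f x" "\<And>x. norm (g x) \<le> B"
        using Tietze[OF f(1), of UNIV B] S B by auto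
      have "(\<lambda>n. \<integral>x. g x \<partial>distr (\<mu> n) borel (\<lambda>x. x)) \<longlonglongrightarrow> (\<integral>x. g x \<partial>distr \<nu> borel (\<lambda>x. x))"
        using g by (intro weak_conv_imp_integral_bdd_continuous_conv[OF rd[OF \<mu>] rd[OF \<nu>] wc])
          (auto simp: continuous_on_eq_continuous_at)
      moreover have "(\<integral>x. g x \<partial>G) = (\<integral>x. f x \<partial>G)"
        if "G \<in> space (prob_algebra (restrict_space borel S))" for G
        using id(2)[OF that] g(2) by (intro Bochner_Integration.integral_cong) auto
      ultimately show "(\<lambda>n. \<integral>x. f x \<partial>\<mu> n) \<longlonglongrightarrow> (\<integral>x. f x \<partial>\<nu>)"
        by (simp add: int[OF _ g(1)] \<mu> \<nu>)
    qed
  qed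
qed

end

theory Submission
  imports Defs
begin

text \<open>
  Newton's update mixes the current measure with its Bayes posterior with weight \<open>\<alpha>\<close>, so under the
  predictive law \<open>p\<^bsub>G\<^sub>n\<^esub>\<close> every \<open>\<integral>f dG\<^sub>n\<close> with \<open>f\<close> bounded is a martingale, and its increments are
  at most \<open>2 \<alpha>\<^sub>n sup \<bar>f\<bar>\<close>.  As \<open>\<Sum>\<alpha>\<^sub>n\<^sup>2 < \<infinity>\<close>, Kolmogorov's inequality gives almost sure convergence.  Applied
  to the countably many monomials, this yields weak convergence: polynomials are uniformly dense in
  the continuous functions on \<open>\<Theta>\<close>, and Helly's theorem supplies the limit measure.  Since the
  Poisson kernel is continuous on \<open>\<Theta>\<close>, both conditional expectations equal \<open>p\<^bsub>G\<^sub>n\<^esub>(y)\<close> by the martingale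
  property.  The empirical frequencies differ from the Cesaro means of \<open>p\<^bsub>G\<^sub>k\<^esub>(y)\<close> by a mean of
  bounded martingale differences, which vanishes by Kronecker's lemma.
\<close>

section \<open>Martingales with bounded increments\<close>

text \<open>The martingale property rests on one cancellation. The posterior mean after observing y
  has \<open>poisson_mixture G y\<close> in its denominator, the predictive probability of y is that
  same number, and the Poisson weights of all y sum to 1; averaging over y therefore returns the
  current mean. The hypothesis speaks of one y at a time, so this average is first cut off at a
  finite bound and then passed to the limit by dominated convergence.

  Conditional statements are used in tested form: as equal expectations against all bounded
  variables Z that are measurable at time n. This form is stable under predictable factors and under
  limits. \<open>expectation_indicator_Suc\<close> translates the hypothesis into it, and
  \<open>real_cond_exp_eq_poisson_mixture\<close> translates back.

  The limit measure is found separately for each outcome, by compactness and a choice, which says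
  nothing about its measurability. That is recovered from the integrals of continuous functions,
  which are pointwise limits of measurable ones.\<close>

lemma tendsto_cesaro_mean:
  fixes x :: "nat \<Rightarrow> real"
  assumes "x \<longlonglongrightarrow> l"
  shows "(\<lambda>n. (\<Sum>k<n. x k) / real n) \<longlonglongrightarrow> l"
proof -
  have "(\<lambda>n. (\<Sum>k<n. x k - l) / real n) \<longlonglongrightarrow> 0"
  proof (rule LIMSEQ_I)
    fix e :: real assume e: "0 < e"
    have "(\<lambda>n. x n - l) \<longlonglongrightarrow> 0"
      using assms by (simp add: LIM_zero)
    then obtain N where N: "\<And>n. n \<ge> N \<Longrightarrow> \<bar>x n - l\<bar> < e / 2"
      using LIMSEQ_D[of "\<lambda>n. x n - l" 0 "e / 2"] e by auto
    define C where "C = (\<Sum>k<N. \<bar>x k - l\<bar>)"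
    \<comment> \<open>Beyond K the fixed head C is less than half of \<open>n * e\<close>; the terms
      from N on contribute at most \<open>e / 2\<close> each.\<close>
    obtain K :: nat where K: "2 * C / e < real K"
      using reals_Archimedean2 by blast
    show "\<exists>no. \<forall>n\<ge>no. norm ((\<Sum>k<n. x k - l) / real n - 0) < e"
    proof (intro exI allI impI)
      fix n assume n: "n \<ge> Suc (max N K)"
      have "\<bar>\<Sum>k<n. x k - l\<bar> \<le> (\<Sum>k<n. \<bar>x k - l\<bar>)"
        by (rule sum_abs)
      also have "\<dots> = C + (\<Sum>k\<in>{N..<n}. \<bar>x k - l\<bar>)"
        using n sum.atLeastLessThan_concat[of 0 N n "\<lambda>k. \<bar>x k - l\<bar>"]
        by (simp add: C_def atLeast0LessThan)
      also have "(\<Sum>k\<in>{N..<n}. \<bar>x k - l\<bar>) \<le> (\<Sum>k\<in>{N..<n}. e / 2)"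
        using N by (intro sum_mono less_imp_le) auto
      also have "\<dots> \<le> real n * (e / 2)"
        using e by (simp add: mult_right_mono)
      also have "C < real n * (e / 2)"
      proof -
        have "2 * C / e < real n"
          using K n by linarith
        then show ?thesis
          using e by (simp add: field_simps)
      qed
      finally have "\<bar>\<Sum>k<n. x k - l\<bar> < real n * e" by (simp add: field_simps)
      then show "norm ((\<Sum>k<n. x k - l) / real n - 0) < e"
        using n by (simp add: field_simps)
    qed
  qed
  then have "(\<lambda>n. (\<Sum>k<n. x k - l) / real n + l) \<longlonglongrightarrow> 0 + l"
    by (intro tendsto_intros)
  moreover have "\<forall>\<^sub>F n in sequentially. (\<Sum>k<n. x k - l) / real n + l = (\<Sum>k<n. x k) / real n"
    using eventually_gt_at_top[of 0]
    by eventually_elim (simp add: sum_subtractf field_simps)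
  ultimately show ?thesis
    by (simp add: tendsto_cong)
qed

text \<open>Summation by parts turns the mean of x into \<open>T n\<close> minus the Cesaro mean of
  T, where T are the partial sums of the weighted series. Both have the same limit.\<close>

lemma kronecker_mean_tendsto_0:
  fixes x :: "nat \<Rightarrow> real"
  assumes "summable (\<lambda>k. x k / real (Suc k))"
  shows "(\<lambda>n. (\<Sum>k<n. x k) / real n) \<longlonglongrightarrow> 0"
proof -
  define T where "T = (\<lambda>n. \<Sum>k<n. x k / real (Suc k))"
  obtain l where l: "T \<longlonglongrightarrow> l"
    using assms unfolding summable_def sums_def T_def by auto
  have parts: "(\<Sum>k<n. x k) = real n * T n - (\<Sum>k<n. T k)" for n
  proof (induction n)
    case (Suc n)
    have "T (Suc n) = T n + x n / real (Suc n)"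
      by (simp add: T_def)
    then have "x n = real (Suc n) * T (Suc n) - real (Suc n) * T n"
      by (simp add: distrib_left del: of_nat_Suc)
    then show ?case
      using Suc by (simp add: algebra_simps)
  qed (simp add: T_def)
  have "(\<lambda>n. T n - (\<Sum>k<n. T k) / real n) \<longlonglongrightarrow> l - l"
    by (intro tendsto_intros l tendsto_cesaro_mean)
  moreover have "\<forall>\<^sub>F n in sequentially. T n - (\<Sum>k<n. T k) / real n = (\<Sum>k<n. x k) / real n"
    using eventually_gt_at_top[of 0] by eventually_elim (simp add: parts field_simps)
  ultimately show ?thesis
    by (simp add: tendsto_cong)
qed

section \<open>Martingale differences: variance bound, stopping and almost sure convergence\<close>

text \<open>Conditional mean zero is encoded as orthogonality to bounded variables of the past,
  which passes directly to products and shifts. \<open>X n\<close> is the step from time n to time n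
  + 1, hence adapted to \<open>F (Suc n)\<close>, and the sum over \<open>k < n\<close> is known at
  time n. The deterministic bounds c provide integrability and control the variances.\<close>

locale bounded_martingale_difference = prob_space M
  for M :: "'a measure" and F :: "nat \<Rightarrow> 'a measure" and X :: "nat \<Rightarrow> 'a \<Rightarrow> real" and c :: "nat \<Rightarrow> real" +
  assumes subalgebra_F: "subalgebra M (F n)"
    and mono_F: "m \<le> n \<Longrightarrow> sets (F m) \<subseteq> sets (F n)"
    and adapted: "X n \<in> borel_measurable (F (Suc n))"
    and bounded: "\<omega> \<in> space M \<Longrightarrow> \<bar>X n \<omega>\<bar> \<le> c n"
    and orthogonal: "Z \<in> borel_measurable (F n) \<Longrightarrow> (\<And>\<omega>. \<omega> \<in> space M \<Longrightarrow> \<bar>Z \<omega>\<bar> \<le> B) \<Longrightarrow>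
      expectation (\<lambda>\<omega>. Z \<omega> * X n \<omega>) = 0"
begin

lemma space_F: "space (F n) = space M"
  using subalgebra_F by (simp add: subalgebra_def)

lemma measurable_F_mono:
  assumes "f \<in> measurable (F m) N" "m \<le> n"
  shows "f \<in> measurable (F n) N"
  by (rule measurable_from_subalg[OF _ assms(1)])
     (use assms(2) mono_F in \<open>auto simp: subalgebra_def space_F\<close>)

lemma X_measurable [measurable]: "X n \<in> borel_measurable M"
  by (rule measurable_from_subalg[OF subalgebra_F adapted])

lemma partial_sum_measurable_F: "(\<lambda>\<omega>. \<Sum>k<n. X k \<omega>) \<in> borel_measurable (F n)"
  by (intro borel_measurable_sum measurable_F_mono[OF adapted]) auto

lemma partial_sum_bounded: "\<omega> \<in> space M \<Longrightarrow> \<bar>\<Sum>k<n. X k \<omega>\<bar> \<le> (\<Sum>k<n. c k)"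
  by (rule order_trans[OF sum_abs sum_mono]) (use bounded in auto)

lemma integrable_bounded:
  fixes f :: "'a \<Rightarrow> real"
  assumes "f \<in> borel_measurable M" "\<And>\<omega>. \<omega> \<in> space M \<Longrightarrow> \<bar>f \<omega>\<bar> \<le> B"
  shows "integrable M f"
  by (rule integrable_const_bound[where B = B]) (use assms in auto)

lemma integrable_partial_sum_power2: "integrable M (\<lambda>\<omega>. (\<Sum>k<n. X k \<omega>)\<^sup>2)"
  by (rule integrable_bounded[where B = "(\<Sum>k<n. c k)\<^sup>2"])
     (auto simp: abs_le_square_iff[symmetric] intro: order_trans[OF partial_sum_bounded abs_ge_self])

text \<open>The earlier sum is bounded and known at time n, so it is an admissible test variable and
  the cross term vanishes.\<close>

lemma second_moment_le: "expectation (\<lambda>\<omega>. (\<Sum>k<n. X k \<omega>)\<^sup>2) \<le> (\<Sum>k<n. (c k)\<^sup>2)"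
proof (induction n)
  case 0
  then show ?case by simp
next
  case (Suc n)
  let ?S = "\<lambda>\<omega>. \<Sum>k<n. X k \<omega>"
  have Xsq: "\<bar>(X n \<omega>)\<^sup>2\<bar> \<le> (c n)\<^sup>2" if "\<omega> \<in> space M" for \<omega>
    using bounded[OF that, of n] by (auto simp: abs_le_square_iff[symmetric])
  have i1: "integrable M (\<lambda>\<omega>. ?S \<omega> * X n \<omega>)"
    by (rule integrable_bounded[where B = "(\<Sum>k<n. c k) * c n"])
       (use bounded partial_sum_bounded in \<open>auto simp: abs_mult intro!: mult_mono order_trans[OF abs_ge_zero]\<close>)
  have i2: "integrable M (\<lambda>\<omega>. (X n \<omega>)\<^sup>2)"
    using Xsq by (intro integrable_bounded) auto
  have "expectation (\<lambda>\<omega>. (\<Sum>k<Suc n. X k \<omega>)\<^sup>2)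
      = expectation (\<lambda>\<omega>. (?S \<omega>)\<^sup>2 + 2 * (?S \<omega> * X n \<omega>) + (X n \<omega>)\<^sup>2)"
    by (intro Bochner_Integration.integral_cong) (auto simp: power2_eq_square algebra_simps)
  also have "\<dots> = expectation (\<lambda>\<omega>. (?S \<omega>)\<^sup>2) + 2 * expectation (\<lambda>\<omega>. ?S \<omega> * X n \<omega>)
      + expectation (\<lambda>\<omega>. (X n \<omega>)\<^sup>2)"
    using i1 i2 integrable_partial_sum_power2[of n] by simp
  also have "expectation (\<lambda>\<omega>. ?S \<omega> * X n \<omega>) = 0"
    by (rule orthogonal[OF partial_sum_measurable_F partial_sum_bounded])
  also have "expectation (\<lambda>\<omega>. (X n \<omega>)\<^sup>2) \<le> (c n)\<^sup>2"
    using Xsq by (intro integral_le_const i2 AE_I2) auto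
  finally show ?case using Suc by simp
qed

text \<open>The factor \<open>H n\<close> can be absorbed into the test variable, since it is
  bounded and known at time n. Two choices of H are used: an indicator, to stop the sums, and the
  weights 1/(k+1), for Kronecker's lemma.\<close>

lemma predictable_transform:
  assumes "\<And>k. H k \<in> borel_measurable (F k)" and "\<And>k \<omega>. \<omega> \<in> space M \<Longrightarrow> \<bar>H k \<omega>\<bar> \<le> b k"
  shows "bounded_martingale_difference M F (\<lambda>k \<omega>. H k \<omega> * X k \<omega>) (\<lambda>k. b k * c k)"
proof unfold_locales
  fix n
  show "(\<lambda>\<omega>. H n \<omega> * X n \<omega>) \<in> borel_measurable (F (Suc n))"
    using adapted measurable_F_mono[OF assms(1), of n "Suc n"] by auto
next
  fix n \<omega> assume "\<omega> \<in> space M"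
  then show "\<bar>H n \<omega> * X n \<omega>\<bar> \<le> b n * c n"
    using assms(2) bounded by (auto simp: abs_mult intro!: mult_mono order_trans[OF abs_ge_zero])
next
  fix Z :: "'a \<Rightarrow> real" and n B
  assume Z: "Z \<in> borel_measurable (F n)" "\<And>\<omega>. \<omega> \<in> space M \<Longrightarrow> \<bar>Z \<omega>\<bar> \<le> B"
  have "expectation (\<lambda>\<omega>. (Z \<omega> * H n \<omega>) * X n \<omega>) = 0"
    by (rule orthogonal[where B = "B * b n"])
       (use Z assms in \<open>auto simp: abs_mult intro!: mult_mono order_trans[OF abs_ge_zero]\<close>)
  then show "expectation (\<lambda>\<omega>. Z \<omega> * (H n \<omega> * X n \<omega>)) = 0"
    by (simp add: mult.assoc)
qed (use subalgebra_F mono_F in auto)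

text \<open>Restarting at time m makes tail segments into partial sums, so that the maximal
  inequality applies to them.\<close>

lemma shift: "bounded_martingale_difference M (\<lambda>n. F (m + n)) (\<lambda>n. X (m + n)) (\<lambda>n. c (m + n))"
proof unfold_locales
  fix n show "X (m + n) \<in> borel_measurable (F (m + Suc n))"
    using adapted[of "m + n"] by simp
qed (use subalgebra_F mono_F bounded in \<open>auto intro: orthogonal\<close>)

text \<open>Kolmogorov's inequality. A stopped sum keeps its value after the exit, so an exit at any
  time up to n is visible in the single stopped sum at time n, to which Chebyshev's inequality and
  the variance bound apply.\<close>

lemma maximal_inequality:
  assumes "0 < l"
  shows "prob {\<omega> \<in> space M. \<exists>j\<le>n. l \<le> \<bar>\<Sum>k<j. X k \<omega>\<bar>} \<le> (\<Sum>k<n. (c k)\<^sup>2) / l\<^sup>2"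
proof -
  \<comment> \<open>\<open>H k\<close> looks only at sums of index at most k, so it is known at time
    k, before the step \<open>X k\<close>. It switches to 0 for good at the first exit.\<close>
  define H where "H = (\<lambda>k \<omega>. if \<forall>j\<in>{..k}. \<bar>\<Sum>i<j. X i \<omega>\<bar> < l then 1 else 0 :: real)"
  have Sm: "(\<lambda>\<omega>. \<Sum>i<j. X i \<omega>) \<in> borel_measurable (F k)" if "j \<le> k" for j k
    using measurable_F_mono[OF partial_sum_measurable_F that] .
  have H: "H k \<in> borel_measurable (F k)" for k
  proof -
    have "Measurable.pred (F k) (\<lambda>\<omega>. \<forall>j\<in>{..k}. \<bar>\<Sum>i<j. X i \<omega>\<bar> < l)"
      using Sm by (intro pred_intros_finite) auto
    then show ?thesis
      unfolding H_def by (intro measurable_If measurable_const predE) simp_all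
  qed
  interpret S: bounded_martingale_difference M F "\<lambda>k \<omega>. H k \<omega> * X k \<omega>" "\<lambda>k. 1 * c k"
    by (rule predictable_transform[where H = H and b = "\<lambda>k. 1", OF H]) (simp add: H_def)
  \<comment> \<open>The transformed sums are the partial sums of X stopped at the first exit from (-l, l).\<close>
  have before: "(\<Sum>k<m. H k \<omega> * X k \<omega>) = (\<Sum>k<m. X k \<omega>)"
    if "\<forall>j<m. \<bar>\<Sum>i<j. X i \<omega>\<bar> < l" for m \<omega>
    using that by (intro sum.cong) (auto simp: H_def)
  have stopped: "l \<le> \<bar>\<Sum>k<m. H k \<omega> * X k \<omega>\<bar>" if "\<exists>j\<le>m. l \<le> \<bar>\<Sum>k<j. X k \<omega>\<bar>" for m \<omega>
    using that
  proof (induction m)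
    case 0
    then show ?case using assms by auto
  next
    case (Suc m)
    show ?case
    \<comment> \<open>After an earlier exit the factor is 0 and the stopped sum is frozen. Otherwise
      the exit occurs exactly at \<open>Suc m\<close>, and up to there stopped and plain sums
      agree.\<close>
    proof (cases "\<exists>j\<le>m. l \<le> \<bar>\<Sum>k<j. X k \<omega>\<bar>")
      case True
      then have "H m \<omega> = 0" by (auto simp: H_def not_less)
      then show ?thesis using Suc.IH[OF True] by simp
    next
      case False
      then have *: "\<forall>j<Suc m. \<bar>\<Sum>i<j. X i \<omega>\<bar> < l"
        by (meson less_Suc_eq_le not_le)
      have "l \<le> \<bar>\<Sum>k<Suc m. X k \<omega>\<bar>"
        using Suc.prems False by (metis le_Suc_eq)
      then show ?thesis by (simp only: before[OF *])
    qed
  qed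
  have "prob {\<omega> \<in> space M. \<exists>j\<le>n. l \<le> \<bar>\<Sum>k<j. X k \<omega>\<bar>}
      \<le> prob {\<omega> \<in> space M. l \<le> \<bar>\<Sum>k<n. H k \<omega> * X k \<omega>\<bar>}"
  proof (rule finite_measure_mono)
    show "{\<omega> \<in> space M. l \<le> \<bar>\<Sum>k<n. H k \<omega> * X k \<omega>\<bar>} \<in> events"
      using S.X_measurable by measurable
  qed (use stopped in auto)
  also have "\<dots> \<le> expectation (\<lambda>\<omega>. (\<Sum>k<n. H k \<omega> * X k \<omega>)\<^sup>2) / l\<^sup>2"
    using assms S.integrable_partial_sum_power2 S.X_measurable
    by (intro second_moment_method) auto
  also have "\<dots> \<le> (\<Sum>k<n. (c k)\<^sup>2) / l\<^sup>2"
    using S.second_moment_le[of n] by (simp add: divide_right_mono)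
  finally show ?thesis .
qed

lemma maximal_inequality_infinite:
  assumes "0 < l" and "summable (\<lambda>k. (c k)\<^sup>2)"
  shows "prob {\<omega> \<in> space M. \<exists>j. l \<le> \<bar>\<Sum>k<j. X k \<omega>\<bar>} \<le> (\<Sum>k. (c k)\<^sup>2) / l\<^sup>2"
proof -
  let ?A = "\<lambda>n. {\<omega> \<in> space M. \<exists>j\<le>n. l \<le> \<bar>\<Sum>k<j. X k \<omega>\<bar>}"
  have "(\<lambda>n. prob (?A n)) \<longlonglongrightarrow> prob (\<Union>n. ?A n)"
  proof (rule finite_Lim_measure_incseq)
    show "range ?A \<subseteq> events" by auto
    show "incseq ?A" unfolding incseq_def by (auto intro: order_trans)
  qed
  moreover have "prob (?A n) \<le> (\<Sum>k. (c k)\<^sup>2) / l\<^sup>2" for n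
    using maximal_inequality[OF assms(1), of n] sum_le_suminf[OF assms(2), of "{..<n}"]
    by (meson divide_right_mono order_trans finite_lessThan zero_le_power2)
  ultimately have "prob (\<Union>n. ?A n) \<le> (\<Sum>k. (c k)\<^sup>2) / l\<^sup>2"
    by (intro LIMSEQ_le_const2) auto
  also have "(\<Union>n. ?A n) = {\<omega> \<in> space M. \<exists>j. l \<le> \<bar>\<Sum>k<j. X k \<omega>\<bar>}"
    by auto
  finally show ?thesis .
qed

text \<open>If every tail, wherever it starts, has a segment from its start of size at least l, then
  the maximal inequality for the tail from m bounds the probability by a remainder of the convergent
  series of squares. Letting m grow makes this event null. Taking l = 1/(i+1) for all i leaves
  countably many null sets and yields the Cauchy criterion.\<close>

theorem AE_summable:
  assumes "summable (\<lambda>k. (c k)\<^sup>2)"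
  shows "AE \<omega> in M. summable (\<lambda>k. X k \<omega>)"
proof -
  let ?osc = "\<lambda>l m \<omega>. \<exists>j. l \<le> \<bar>\<Sum>k<j. X (m + k) \<omega>\<bar>"
  have AE: "AE \<omega> in M. \<exists>m. \<not> ?osc l m \<omega>" if l: "0 < l" for l :: real
  proof -
    let ?N = "{\<omega> \<in> space M. \<forall>m. ?osc l m \<omega>}"
    have "prob ?N \<le> (\<Sum>k. (c (k + m))\<^sup>2) / l\<^sup>2" for m
    proof -
      interpret S: bounded_martingale_difference M "\<lambda>n. F (m + n)" "\<lambda>n. X (m + n)" "\<lambda>n. c (m + n)"
        by (rule shift)
      have "summable (\<lambda>k. (c (m + k))\<^sup>2)"
        using summable_ignore_initial_segment[OF assms, of m] by (simp add: add.commute)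
      then have "prob {\<omega> \<in> space M. ?osc l m \<omega>} \<le> (\<Sum>k. (c (m + k))\<^sup>2) / l\<^sup>2"
        by (rule S.maximal_inequality_infinite[OF l])
      moreover have "prob ?N \<le> prob {\<omega> \<in> space M. ?osc l m \<omega>}"
        by (intro finite_measure_mono) auto
      ultimately show ?thesis by (simp add: add.commute)
    qed
    moreover have "(\<lambda>m. (\<Sum>k. (c (k + m))\<^sup>2) / l\<^sup>2) \<longlonglongrightarrow> 0 / l\<^sup>2"
      using l by (intro tendsto_divide tendsto_const suminf_exist_split2 assms) auto
    ultimately have "prob ?N \<le> 0"
      by (intro LIMSEQ_le_const) auto
    then have "prob ?N = 0"
      by (simp add: antisym)
    then show ?thesis
      by (intro AE_I[where N = ?N]) (auto simp: emeasure_eq_measure)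
  qed
  have "AE \<omega> in M. \<forall>i. \<exists>m. \<not> ?osc (inverse (real (Suc i))) m \<omega>"
    using AE by (subst AE_all_countable) (auto simp del: of_nat_Suc)
  then show ?thesis
  proof (eventually_elim)
    case (elim \<omega>)
    show ?case
    proof (subst summable_Cauchy, intro allI impI)
      fix e :: real assume "0 < e"
      \<comment> \<open>Half of e, because a segment from a to b is the difference of two segments
        starting at m.\<close>
      then obtain i where i: "inverse (real (Suc i)) < e / 2"
        using reals_Archimedean[of "e / 2"] by auto
      obtain m where m: "\<And>j. \<bar>\<Sum>k<j. X (m + k) \<omega>\<bar> < inverse (real (Suc i))"
        using elim by (meson not_le)
      have seg: "\<bar>\<Sum>k\<in>{m..<b}. X k \<omega>\<bar> < e / 2" if "m \<le> b" for b
        using m[of "b - m"] i sum.shift_bounds_nat_ivl[of "\<lambda>k. X k \<omega>" 0 m "b - m"] that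
        by (simp add: atLeast0LessThan add.commute)
      show "\<exists>N. \<forall>m\<ge>N. \<forall>n. norm (\<Sum>k\<in>{m..<n}. X k \<omega>) < e"
      proof (intro exI allI impI)
        fix a b assume a: "m \<le> a"
        show "norm (\<Sum>k\<in>{a..<b}. X k \<omega>) < e"
        proof (cases "a \<le> b")
          case True
          then have "(\<Sum>k\<in>{a..<b}. X k \<omega>) = (\<Sum>k\<in>{m..<b}. X k \<omega>) - (\<Sum>k\<in>{m..<a}. X k \<omega>)"
            using a sum.atLeastLessThan_concat[of m a b "\<lambda>k. X k \<omega>"] by simp
          then show ?thesis using seg[of a] seg[of b] a True by simp
        qed (use \<open>0 < e\<close> in auto)
      qed
    qed
  qed
qed

text \<open>A constant bound need not be square summable. The weights 1/(k+1) make it so, and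
  Kronecker's lemma converts the weighted series back into plain means.\<close>

theorem AE_mean_tendsto_0:
  assumes "\<And>k. c k = C"
  shows "AE \<omega> in M. (\<lambda>n. (\<Sum>k<n. X k \<omega>) / real n) \<longlonglongrightarrow> 0"
proof -
  interpret S: bounded_martingale_difference M F "\<lambda>k \<omega>. 1 / real (Suc k) * X k \<omega>" "\<lambda>k. 1 / real (Suc k) * c k"
    by (rule predictable_transform[where H = "\<lambda>k \<omega>. 1 / real (Suc k)" and b = "\<lambda>k. 1 / real (Suc k)"])
       (simp_all del: of_nat_Suc)
  have "summable (\<lambda>k. inverse (real (Suc k) ^ 2) * C\<^sup>2)"
    by (intro summable_mult2 iffD2[OF summable_Suc_iff[of "\<lambda>n. inverse (real n ^ 2)"]]
        inverse_power_summable) auto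
  also have "(\<lambda>k. inverse (real (Suc k) ^ 2) * C\<^sup>2) = (\<lambda>k. (1 / real (Suc k) * c k)\<^sup>2)"
    by (simp only: assms power_mult_distrib power_divide power_one inverse_eq_divide)
  finally have "summable (\<lambda>k. (1 / real (Suc k) * c k)\<^sup>2)" .
  from S.AE_summable[OF this] show ?thesis
    by eventually_elim (rule kronecker_mean_tendsto_0, simp)
qed

end

section \<open>Probability measures on a compact set of positive reals\<close>

locale compact_positive_support =
  fixes \<Theta> :: "real set"
  assumes compact_support: "compact \<Theta>" and positive_support: "\<Theta> \<subseteq> {0<..}"
begin

abbreviation "probs \<equiv> space (prob_algebra (restrict_space borel \<Theta>))"

lemma probsD:
  assumes "G \<in> probs"
  shows "prob_space G" "sets G = sets (restrict_space borel \<Theta>)" "space G = \<Theta>"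
    and "f \<in> borel_measurable (restrict_space borel \<Theta>) \<Longrightarrow> f \<in> borel_measurable G"
proof -
  show "prob_space G" and s: "sets G = sets (restrict_space borel \<Theta>)"
    using assms by (auto simp: space_prob_algebra)
  show "space G = \<Theta>"
    using sets_eq_imp_space_eq[OF s] by (simp add: space_restrict_space)
  show "f \<in> borel_measurable (restrict_space borel \<Theta>) \<Longrightarrow> f \<in> borel_measurable G"
    by (simp add: measurable_cong_sets[OF s])
qed

lemma integrable_bounded_probs:
  fixes f :: "real \<Rightarrow> real"
  assumes "G \<in> probs" "f \<in> borel_measurable (restrict_space borel \<Theta>)"
    and "\<And>\<theta>. \<theta> \<in> \<Theta> \<Longrightarrow> \<bar>f \<theta>\<bar> \<le> B"
  shows "integrable G f"
proof -
  interpret prob_space G using probsD[OF assms(1)] by simp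
  show ?thesis
    using assms probsD[OF assms(1)] by (intro integrable_const_bound[where B = B]) auto
qed

lemma abs_integral_le_probs:
  fixes f :: "real \<Rightarrow> real"
  assumes "G \<in> probs" "f \<in> borel_measurable (restrict_space borel \<Theta>)"
    and "\<And>\<theta>. \<theta> \<in> \<Theta> \<Longrightarrow> \<bar>f \<theta>\<bar> \<le> B"
  shows "\<bar>\<integral>\<theta>. f \<theta> \<partial>G\<bar> \<le> B"
proof -
  interpret prob_space G using probsD[OF assms(1)] by simp
  have "\<bar>\<integral>\<theta>. f \<theta> \<partial>G\<bar> \<le> (\<integral>\<theta>. \<bar>f \<theta>\<bar> \<partial>G)"
    by (rule integral_abs_bound)
  also have "\<dots> \<le> B"
    using assms(3) probsD(3)[OF assms(1)]
    by (intro integral_le_const AE_I2 integrable_abs integrable_bounded_probs[OF assms]) auto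
  finally show ?thesis .
qed

section \<open>The Poisson kernel, its mixtures and Newton's update\<close>

lemma poisson_measurable: "(\<lambda>\<theta>. pmf (poisson_pmf \<theta>) y) \<in> borel_measurable (restrict_space borel \<Theta>)"
  by (rule measurable_poisson[OF positive_support refl])

lemma poisson_times_measurable:
  "f \<in> borel_measurable (restrict_space borel \<Theta>) \<Longrightarrow>
    (\<lambda>\<theta>. f \<theta> * pmf (poisson_pmf \<theta>) y) \<in> borel_measurable (restrict_space borel \<Theta>)"
  using poisson_measurable by (intro borel_measurable_times) auto

lemma poisson_times_bounded: "\<bar>z\<bar> \<le> B \<Longrightarrow> \<bar>z * pmf (poisson_pmf \<theta>) y\<bar> \<le> B"
  using mult_left_mono[OF pmf_le_1[of "poisson_pmf \<theta>" y] abs_ge_zero[of z]] by (simp add: abs_mult)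

text \<open>This makes the quotient in Newton's update a genuine division for every y. A positive
  rate gives each y positive Poisson weight, and a nonnegative function with integral 0 vanishes
  almost everywhere.\<close>

lemma poisson_mixture_pos:
  assumes "G \<in> probs"
  shows "0 < poisson_mixture G y"
proof -
  interpret prob_space G using probsD[OF assms(1)] by simp
  have int: "integrable G (\<lambda>\<theta>. pmf (poisson_pmf \<theta>) y)"
    by (rule integrable_bounded_probs[OF assms poisson_measurable, where B = 1]) (simp add: pmf_le_1)
  have pos: "0 < pmf (poisson_pmf \<theta>) y" if "\<theta> \<in> space G" for \<theta>
    using that probsD(3)[OF assms] positive_support by auto
  have "0 \<le> poisson_mixture G y"
    unfolding poisson_mixture_def by simp
  moreover have "poisson_mixture G y \<noteq> 0"
  proof
    assume "poisson_mixture G y = 0"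
    then have "AE \<theta> in G. pmf (poisson_pmf \<theta>) y = 0"
      using integral_nonneg_eq_0_iff_AE[OF int] by (simp add: poisson_mixture_def)
    then have "AE \<theta> in G. False"
      using AE_space by eventually_elim (use pos in force)
    then show False by simp
  qed
  ultimately show ?thesis by simp
qed

text \<open>Divided by the mixture, this bounds the posterior mean of f by B, which later bounds the
  martingale increments.\<close>

lemma abs_integral_poisson_le:
  assumes "G \<in> probs" "f \<in> borel_measurable (restrict_space borel \<Theta>)"
    and "\<And>\<theta>. \<theta> \<in> \<Theta> \<Longrightarrow> \<bar>f \<theta>\<bar> \<le> B"
  shows "\<bar>\<integral>\<theta>. f \<theta> * pmf (poisson_pmf \<theta>) y \<partial>G\<bar> \<le> B * poisson_mixture G y"
proof -
  have "\<bar>\<integral>\<theta>. f \<theta> * pmf (poisson_pmf \<theta>) y \<partial>G\<bar> \<le> (\<integral>\<theta>. \<bar>f \<theta> * pmf (poisson_pmf \<theta>) y\<bar> \<partial>G)"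
    by (rule integral_abs_bound)
  also have "\<dots> \<le> (\<integral>\<theta>. B * pmf (poisson_pmf \<theta>) y \<partial>G)"
  proof (rule integral_mono)
    show "integrable G (\<lambda>\<theta>. \<bar>f \<theta> * pmf (poisson_pmf \<theta>) y\<bar>)"
      using assms
      by (intro integrable_abs integrable_bounded_probs[where B = B] poisson_times_measurable poisson_times_bounded)
    show "integrable G (\<lambda>\<theta>. B * pmf (poisson_pmf \<theta>) y)"
      by (intro integrable_mult_right integrable_bounded_probs[OF assms(1) poisson_measurable, where B = 1])
         (simp add: pmf_le_1)
  qed (use assms(3) probsD(3)[OF assms(1)] in \<open>auto simp: abs_mult intro: mult_right_mono\<close>)
  finally show ?thesis
    by (simp add: poisson_mixture_def)
qed

text \<open>The total mass is \<open>(1 - a) + a * (c / c)\<close> with c the mixture, so positivity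
  of c is what makes it 1. The integral formula displays the update as a mixture of the current mean
  and the posterior mean.\<close>

lemma
  assumes G: "G \<in> probs" and a: "0 < a" "a < 1"
  shows newton_update_probs: "newton_update a y G \<in> probs"
    and integral_newton_update: "f \<in> borel_measurable (restrict_space borel \<Theta>) \<Longrightarrow>
      (\<And>\<theta>. \<theta> \<in> \<Theta> \<Longrightarrow> \<bar>f \<theta>\<bar> \<le> B) \<Longrightarrow>
      (\<integral>\<theta>. f \<theta> \<partial>newton_update a y G) = (1 - a) * (\<integral>\<theta>. f \<theta> \<partial>G)
        + a * ((\<integral>\<theta>. f \<theta> * pmf (poisson_pmf \<theta>) y \<partial>G) / poisson_mixture G y)"
proof -
  interpret prob_space G using probsD[OF G] by simp
  have s: "sets (newton_update a y G) = sets G"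
    by (simp add: newton_update_def)
  have "measure (newton_update a y G) (space G) = 1"
    using measure_newton_update[OF positive_support G a, of "space G" y] poisson_mixture_pos[OF G, of y] prob_space
    by (simp add: set_lebesgue_integral_def poisson_mixture_def cong: Bochner_Integration.integral_cong)
  \<comment> \<open>An infinite mass would make \<open>measure\<close> equal to 0, so the value 1
    determines \<open>emeasure\<close>.\<close>
  then have "emeasure (newton_update a y G) (space G) = 1"
    by (cases "emeasure (newton_update a y G) (space G)") (auto simp: measure_def)
  then have "prob_space (newton_update a y G)"
    by (intro prob_spaceI) (simp add: sets_eq_imp_space_eq[OF s])
  then show "newton_update a y G \<in> probs"
    using s probsD(2)[OF G] by (simp add: space_prob_algebra)
  assume f: "f \<in> borel_measurable (restrict_space borel \<Theta>)" and B: "\<And>\<theta>. \<theta> \<in> \<Theta> \<Longrightarrow> \<bar>f \<theta>\<bar> \<le> B"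
  let ?c = "poisson_mixture G y"
  let ?d = "\<lambda>\<theta>. (1 - a) + a * (pmf (poisson_pmf \<theta>) y / ?c)"
  have c: "0 < ?c" by (rule poisson_mixture_pos[OF G])
  have d: "0 \<le> ?d \<theta>" for \<theta>
    using c a by (intro add_nonneg_nonneg mult_nonneg_nonneg divide_nonneg_nonneg) auto
  have [measurable]: "f \<in> borel_measurable G" "(\<lambda>\<theta>. pmf (poisson_pmf \<theta>) y) \<in> borel_measurable G"
    using f poisson_measurable by (auto intro: probsD(4)[OF G])
  have "(\<integral>\<theta>. f \<theta> \<partial>newton_update a y G) = (\<integral>\<theta>. ?d \<theta> *\<^sub>R f \<theta> \<partial>G)"
    unfolding newton_update_def using d by (intro integral_density) auto
  also have "\<dots> = (\<integral>\<theta>. (1 - a) * f \<theta> + a / ?c * (f \<theta> * pmf (poisson_pmf \<theta>) y) \<partial>G)"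
    by (intro Bochner_Integration.integral_cong) (auto simp: algebra_simps)
  also have "\<dots> = (1 - a) * (\<integral>\<theta>. f \<theta> \<partial>G) + a / ?c * (\<integral>\<theta>. f \<theta> * pmf (poisson_pmf \<theta>) y \<partial>G)"
    using integrable_bounded_probs[OF G f B]
      integrable_bounded_probs[OF G poisson_times_measurable[OF f] poisson_times_bounded[OF B]]
    by (subst Bochner_Integration.integral_add) auto
  finally show "(\<integral>\<theta>. f \<theta> \<partial>newton_update a y G) = (1 - a) * (\<integral>\<theta>. f \<theta> \<partial>G)
        + a * ((\<integral>\<theta>. f \<theta> * pmf (poisson_pmf \<theta>) y \<partial>G) / ?c)"
    by simp
qed

lemma newton_probs:
  assumes "G0 \<in> probs" "\<And>n. n \<ge> 1 \<Longrightarrow> 0 < \<alpha> n \<and> \<alpha> n < 1"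
  shows "newton G0 \<alpha> y n \<in> probs"
  by (induction n) (use assms newton_update_probs in auto)

lemma sum_poisson_le_1: "(\<Sum>y<N. pmf (poisson_pmf \<theta>) y) \<le> 1"
  using measure_measure_pmf_finite[of "{..<N}" "poisson_pmf \<theta>"]
    measure_pmf.prob_le_1[of "poisson_pmf \<theta>" "{..<N}"] by simp

lemma sum_poisson_tendsto_1: "(\<lambda>N. \<Sum>y<N. pmf (poisson_pmf \<theta>) y) \<longlonglongrightarrow> 1"
proof -
  have "(\<lambda>N. measure (measure_pmf (poisson_pmf \<theta>)) {..<N}) \<longlonglongrightarrow>
      measure (measure_pmf (poisson_pmf \<theta>)) (\<Union>N. {..<N})"
    by (intro measure_pmf.finite_Lim_measure_incseq) (auto simp: incseq_def)
  moreover have "(\<Union>N::nat. {..<N}) = UNIV"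
    by auto
  ultimately show ?thesis
    by (simp add: measure_measure_pmf_finite)
qed

lemma sum_poisson_mixture_le_1:
  assumes G: "G \<in> probs"
  shows "(\<Sum>y<N. poisson_mixture G y) \<le> 1"
proof -
  interpret prob_space G using probsD[OF G] by simp
  have int: "integrable G (\<lambda>\<theta>. pmf (poisson_pmf \<theta>) y)" for y
    by (rule integrable_bounded_probs[OF G poisson_measurable, where B = 1]) (simp add: pmf_le_1)
  have "(\<Sum>y<N. poisson_mixture G y) = (\<integral>\<theta>. (\<Sum>y<N. pmf (poisson_pmf \<theta>) y) \<partial>G)"
    unfolding poisson_mixture_def using int by simp
  also have "\<dots> \<le> 1"
    using int sum_poisson_le_1 by (intro integral_le_const) auto
  finally show ?thesis .
qed

text \<open>The source of the martingale property: the unnormalised posterior integrals of f add up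
  over y to its current integral. With f = 1 it says that the mixture weights sum to 1.\<close>

lemma sum_integral_poisson_tendsto:
  assumes G: "G \<in> probs" and f: "f \<in> borel_measurable (restrict_space borel \<Theta>)"
    and B: "\<And>\<theta>. \<theta> \<in> \<Theta> \<Longrightarrow> \<bar>f \<theta>\<bar> \<le> B"
  shows "(\<lambda>N. \<Sum>y<N. \<integral>\<theta>. f \<theta> * pmf (poisson_pmf \<theta>) y \<partial>G) \<longlonglongrightarrow> (\<integral>\<theta>. f \<theta> \<partial>G)"
proof -
  interpret prob_space G using probsD[OF G] by simp
  have [measurable]: "f \<in> borel_measurable G" "\<And>y. (\<lambda>\<theta>. pmf (poisson_pmf \<theta>) y) \<in> borel_measurable G"
    using f poisson_measurable by (auto intro: probsD(4)[OF G])
  have "(\<lambda>N. \<integral>\<theta>. f \<theta> * (\<Sum>y<N. pmf (poisson_pmf \<theta>) y) \<partial>G) \<longlonglongrightarrow> (\<integral>\<theta>. f \<theta> * 1 \<partial>G)"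
  proof (rule integral_dominated_convergence[where w = "\<lambda>_. B"])
    show "AE \<theta> in G. (\<lambda>N. f \<theta> * (\<Sum>y<N. pmf (poisson_pmf \<theta>) y)) \<longlonglongrightarrow> f \<theta> * 1"
    proof (intro AE_I2 tendsto_mult tendsto_const)
      fix \<theta> show "(\<lambda>N. \<Sum>y<N. pmf (poisson_pmf \<theta>) y) \<longlonglongrightarrow> 1"
        by (rule sum_poisson_tendsto_1)
    qed
    show "AE \<theta> in G. norm (f \<theta> * (\<Sum>y<N. pmf (poisson_pmf \<theta>) y)) \<le> B" for N
    proof (rule AE_I2)
      fix \<theta> assume "\<theta> \<in> space G"
      then have "\<bar>f \<theta>\<bar> * \<bar>\<Sum>y<N. pmf (poisson_pmf \<theta>) y\<bar> \<le> B * 1"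
        using B probsD(3)[OF G] sum_poisson_le_1[of \<theta> N]
        by (intro mult_mono) (auto simp: sum_nonneg intro: order_trans[OF abs_ge_zero])
      then show "norm (f \<theta> * (\<Sum>y<N. pmf (poisson_pmf \<theta>) y)) \<le> B"
        by (simp add: abs_mult)
    qed
  qed auto
  moreover have "(\<integral>\<theta>. f \<theta> * (\<Sum>y<N. pmf (poisson_pmf \<theta>) y) \<partial>G)
      = (\<Sum>y<N. \<integral>\<theta>. f \<theta> * pmf (poisson_pmf \<theta>) y \<partial>G)" for N
    unfolding sum_distrib_left
    using integrable_bounded_probs[OF G poisson_times_measurable[OF f] poisson_times_bounded[OF B]]
    by simp
  ultimately show ?thesis by simp
qed

section \<open>Weak limits from convergent moments\<close>

lemma continuous_measurable:
  "continuous_on \<Theta> f \<Longrightarrow> f \<in> borel_measurable (restrict_space borel \<Theta>)"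
  by (rule borel_measurable_continuous_on_restrict)

lemma continuous_bounded:
  fixes f :: "real \<Rightarrow> real"
  assumes "continuous_on \<Theta> f"
  obtains B where "0 < B" "\<And>\<theta>. \<theta> \<in> \<Theta> \<Longrightarrow> \<bar>f \<theta>\<bar> \<le> B"
  using compact_imp_bounded[OF compact_continuous_image[OF assms compact_support]]
  by (auto simp: bounded_pos)

lemma poisson_continuous: "continuous_on \<Theta> (\<lambda>\<theta>. pmf (poisson_pmf \<theta>) y)"
proof -
  have "continuous_on \<Theta> (\<lambda>\<theta>. \<theta> ^ y / fact y * exp (- \<theta>))"
    by (intro continuous_intros) auto
  then show ?thesis
    by (rule continuous_on_eq) (use positive_support in auto)
qed

text \<open>The integrals of an approximating polynomial are finite combinations of moments. The
  approximation error stays below e/3 uniformly in n because every \<open>\<mu> n\<close> has mass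
  1.\<close>

lemma convergent_integral_continuous:
  fixes f :: "real \<Rightarrow> real"
  assumes \<mu>: "\<And>n. \<mu> n \<in> probs" and moments: "\<And>j. convergent (\<lambda>n. \<integral>\<theta>. \<theta> ^ j \<partial>\<mu> n)"
    and f: "continuous_on \<Theta> f"
  shows "convergent (\<lambda>n. \<integral>\<theta>. f \<theta> \<partial>\<mu> n)"
proof -
  have integrable_cont: "integrable (\<mu> n) g" if "continuous_on \<Theta> g" for n and g :: "real \<Rightarrow> real"
    using continuous_bounded[OF that] integrable_bounded_probs[OF \<mu> continuous_measurable[OF that]] by metis
  have "Cauchy (\<lambda>n. \<integral>\<theta>. f \<theta> \<partial>\<mu> n)"
  proof (rule metric_CauchyI)
    fix e :: real assume e: "0 < e"
    obtain g where g: "real_polynomial_function g" "\<And>x. x \<in> \<Theta> \<Longrightarrow> \<bar>f x - g x\<bar> < e / 3"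
      using Stone_Weierstrass_real_polynomial_function[OF compact_support f, of "e / 3"] e by auto
    obtain a N where a: "g = (\<lambda>x. \<Sum>i\<le>N. a i * x ^ i)"
      using g(1) by (auto simp: real_polynomial_function_iff_sum)
    have g_cont: "continuous_on \<Theta> g"
      unfolding a by (intro continuous_intros)
    have "(\<integral>\<theta>. g \<theta> \<partial>\<mu> n) = (\<Sum>i\<le>N. a i * (\<integral>\<theta>. \<theta> ^ i \<partial>\<mu> n))" for n
      unfolding a by (subst Bochner_Integration.integral_sum)
        (auto intro!: integrable_cont continuous_intros)
    moreover have "convergent (\<lambda>n. \<Sum>i\<le>N. a i * (\<integral>\<theta>. \<theta> ^ i \<partial>\<mu> n))"
      by (intro convergent_sum convergent_mult convergent_const moments)
    ultimately have "Cauchy (\<lambda>n. \<integral>\<theta>. g \<theta> \<partial>\<mu> n)"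
      by (simp add: Cauchy_convergent_iff)
    then obtain K where K: "\<And>m n. m \<ge> K \<Longrightarrow> n \<ge> K \<Longrightarrow> dist (\<integral>\<theta>. g \<theta> \<partial>\<mu> m) (\<integral>\<theta>. g \<theta> \<partial>\<mu> n) < e / 3"
      using metric_CauchyD[of "\<lambda>n. \<integral>\<theta>. g \<theta> \<partial>\<mu> n" "e / 3"] e by auto
    have near: "\<bar>(\<integral>\<theta>. f \<theta> \<partial>\<mu> n) - (\<integral>\<theta>. g \<theta> \<partial>\<mu> n)\<bar> \<le> e / 3" for n
    proof -
      have "\<bar>\<integral>\<theta>. f \<theta> - g \<theta> \<partial>\<mu> n\<bar> \<le> e / 3"
        using g(2) by (intro abs_integral_le_probs[OF \<mu>] continuous_measurable continuous_on_diff f g_cont less_imp_le)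
      then show ?thesis
        using integrable_cont[OF f] integrable_cont[OF g_cont] by simp
    qed
    show "\<exists>K. \<forall>m\<ge>K. \<forall>n\<ge>K. dist (\<integral>\<theta>. f \<theta> \<partial>\<mu> m) (\<integral>\<theta>. f \<theta> \<partial>\<mu> n) < e"
    proof (intro exI allI impI)
      fix m n assume "m \<ge> K" "n \<ge> K"
      then show "dist (\<integral>\<theta>. f \<theta> \<partial>\<mu> m) (\<integral>\<theta>. f \<theta> \<partial>\<mu> n) < e"
        using near[of m] near[of n] K[of m n] unfolding dist_real_def by linarith
    qed
  qed
  then show ?thesis
    by (simp add: Cauchy_convergent_iff)
qed

text \<open>Helly's theorem concerns the real line, so the measures are pushed forward along the
  inclusion. Boundedness of \<Theta> gives tightness, and closedness keeps the limit on \<Theta>, to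
  which it can then be restricted.\<close>

lemma ex_subseq_weak_limit:
  fixes \<mu> :: "nat \<Rightarrow> real measure"
  assumes \<mu>: "\<And>n. \<mu> n \<in> probs"
  obtains r \<nu> where "strict_mono r" "\<nu> \<in> probs" "weak_conv_on \<Theta> (\<mu> \<circ> r) \<nu>"
proof -
  define m where "m n = distr (\<mu> n) borel (\<lambda>x. x)" for n
  have id: "(\<lambda>x. x) \<in> borel_measurable G" if "G \<in> probs" for G
    by (rule probsD(4)[OF that]) (simp add: measurable_restrict_space1)
  have rd: "real_distribution (m n)" for n
    unfolding m_def
    using id[OF \<mu>] probsD(1)[OF \<mu>] by (intro real_distribution.intro prob_space.prob_space_distr)
      (auto intro: real_distribution_axioms.intro)
  have \<Theta>_borel: "\<Theta> \<in> sets borel"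
    using compact_support by (intro borel_compact)
  have m_int: "(\<integral>x. f x \<partial>m n) = (\<integral>x. f x \<partial>\<mu> n)" if "f \<in> borel_measurable borel" for n and f :: "real \<Rightarrow> real"
    unfolding m_def using id[OF \<mu>] that by (subst integral_distr) auto
  obtain B where B: "0 < B" "\<And>\<theta>. \<theta> \<in> \<Theta> \<Longrightarrow> \<bar>\<theta>\<bar> \<le> B"
    using compact_imp_bounded[OF compact_support] by (auto simp: bounded_pos)
  have "tight m"
    unfolding tight_def
  proof (intro conjI allI impI rd)
    fix e :: real assume e: "0 < e"
    \<comment> \<open>The interval is open on the left, so its left end lies strictly below
      -B.\<close>
    have "measure (m n) {- B - 1<..B} = 1" for n
    proof -
      have "measure (m n) {- B - 1<..B} = measure (\<mu> n) ({- B - 1<..B} \<inter> space (\<mu> n))"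
        unfolding m_def using id[OF \<mu>] by (subst measure_distr) auto
      also have "{- B - 1<..B} \<inter> space (\<mu> n) = space (\<mu> n)"
        using B(2) probsD(3)[OF \<mu>] by fastforce
      finally show ?thesis
        using prob_space.prob_space[OF probsD(1)[OF \<mu>]] by simp
    qed
    then show "\<exists>a b. a < b \<and> (\<forall>n. 1 - e < measure (m n) {a<..b})"
      using e B(1) by (intro exI[of _ "- B - 1"] exI[of _ B]) auto
  qed
  then obtain r \<nu>0 where r: "strict_mono r" and \<nu>0: "real_distribution \<nu>0" and wc: "weak_conv_m (m \<circ> id \<circ> r) \<nu>0"
    using tight_imp_convergent_subsubsequence[OF _ strict_mono_id] by blast
  interpret \<nu>0: real_distribution \<nu>0 by fact
  \<comment> \<open>\<open>infdist\<close> to the empty set is constantly 0; nonemptiness lets its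
    zeros identify the points of \<Theta>.\<close>
  have ne: "\<Theta> \<noteq> {}"
    using prob_space.not_empty[OF probsD(1)[OF \<mu>[of 0]]] probsD(3)[OF \<mu>[of 0]] by simp
  \<comment> \<open>No mass escapes from the closed set, as seen by testing against a truncated distance to it.\<close>
  define d where "d x = min 1 (infdist x \<Theta>)" for x :: real
  have d: "continuous_on UNIV d" "\<And>x. \<bar>d x\<bar> \<le> 1" "\<And>x. 0 \<le> d x"
    unfolding d_def by (auto intro!: continuous_intros simp: infdist_nonneg)
  have d_meas: "d \<in> borel_measurable borel"
    using d(1) by (rule borel_measurable_continuous_onI)
  have "(\<lambda>n. \<integral>x. d x \<partial>(m \<circ> id \<circ> r) n) \<longlonglongrightarrow> (\<integral>x. d x \<partial>\<nu>0)"
    using d by (intro weak_conv_imp_integral_bdd_continuous_conv[OF _ \<nu>0 wc, of d 1])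
      (auto simp: rd continuous_on_eq_continuous_at)
  moreover have "(\<integral>x. d x \<partial>(m \<circ> id \<circ> r) n) = 0" for n
  proof -
    have "(\<integral>x. d x \<partial>\<mu> (r n)) = (\<integral>x. 0 \<partial>\<mu> (r n))"
      using probsD(3)[OF \<mu>] by (intro Bochner_Integration.integral_cong) (auto simp: d_def)
    then show ?thesis by (simp add: m_int[OF d_meas])
  qed
  ultimately have "(\<integral>x. d x \<partial>\<nu>0) = 0"
    by (simp add: LIMSEQ_const_iff)
  moreover have "integrable \<nu>0 d"
    using d d_meas by (intro \<nu>0.integrable_const_bound[where B = 1]) auto
  ultimately have "AE x in \<nu>0. d x = 0"
    using d(3) by (subst (asm) integral_nonneg_eq_0_iff_AE) auto
  then have AE_\<Theta>: "AE x in \<nu>0. x \<in> \<Theta>"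
    by eventually_elim
       (use in_closed_iff_infdist_zero[OF compact_imp_closed[OF compact_support] ne] in \<open>auto simp: d_def min_def split: if_splits\<close>)
  define \<nu> where "\<nu> = restrict_space \<nu>0 \<Theta>"
  have s: "sets \<nu> = sets (restrict_space borel \<Theta>)"
    unfolding \<nu>_def by (rule sets_restrict_space_cong) simp
  have "emeasure \<nu>0 \<Theta> = 1"
    using AE_\<Theta> \<Theta>_borel by (intro \<nu>0.emeasure_eq_1_AE) auto
  then have "prob_space \<nu>"
    using \<Theta>_borel unfolding \<nu>_def by (intro prob_spaceI) (simp add: emeasure_restrict_space space_restrict_space)
  then have \<nu>: "\<nu> \<in> probs"
    using s by (simp add: space_prob_algebra)
  \<comment> \<open>The restriction discards only a null set, so pushing forward recovers
    \<open>\<nu>0\<close> and convergence on the line becomes weak convergence on \<Theta>.\<close>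
  have "distr \<nu> borel (\<lambda>x. x) = \<nu>0"
  proof (rule measure_eqI)
    fix A assume "A \<in> sets (distr \<nu> borel (\<lambda>x. x))"
    then have A: "A \<in> sets borel" by simp
    have "emeasure (distr \<nu> borel (\<lambda>x. x)) A = emeasure \<nu> (A \<inter> \<Theta>)"
      using A id[OF \<nu>] probsD(3)[OF \<nu>] by (subst emeasure_distr) auto
    also have "\<dots> = emeasure \<nu>0 (A \<inter> \<Theta>)"
      unfolding \<nu>_def using \<Theta>_borel by (intro emeasure_restrict_space) auto
    also have "\<dots> = emeasure \<nu>0 A"
      using A AE_\<Theta> \<Theta>_borel by (intro emeasure_eq_AE) auto
    finally show "emeasure (distr \<nu> borel (\<lambda>x. x)) A = emeasure \<nu>0 A" .
  qed simp
  moreover have "m \<circ> id \<circ> r = (\<lambda>n. distr ((\<mu> \<circ> r) n) borel (\<lambda>x. x))"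
    by (simp add: m_def comp_def)
  ultimately have "weak_conv_on \<Theta> (\<mu> \<circ> r) \<nu>"
    using wc weak_conv_on_iff_weak_conv_m[OF compact_imp_closed[OF compact_support], of "\<mu> \<circ> r" \<nu>] \<mu> \<nu>
    by simp
  then show thesis
    using that r \<nu> by blast
qed

text \<open>Convergent moments already force the integrals of each continuous function to converge
  along the full sequence. The subsequence serves to identify all these limits as integrals against
  one measure.\<close>

theorem ex_weak_limit:
  assumes \<mu>: "\<And>n. \<mu> n \<in> probs" and moments: "\<And>j. convergent (\<lambda>n. \<integral>\<theta>. \<theta> ^ j \<partial>\<mu> n)"
  shows "\<exists>\<nu>\<in>probs. weak_conv_on \<Theta> \<mu> \<nu>"
proof -
  obtain r \<nu> where r: "strict_mono r" and \<nu>: "\<nu> \<in> probs" and wc: "weak_conv_on \<Theta> (\<mu> \<circ> r) \<nu>"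
    by (rule ex_subseq_weak_limit[of \<mu>, OF \<mu>])
  have "weak_conv_on \<Theta> \<mu> \<nu>"
    unfolding weak_conv_on_def
  proof (intro allI impI)
    fix f :: "real \<Rightarrow> real" assume f: "continuous_on \<Theta> f \<and> bounded (f ` \<Theta>)"
    then obtain l where l: "(\<lambda>n. \<integral>x. f x \<partial>\<mu> n) \<longlonglongrightarrow> l"
      using convergent_integral_continuous[OF \<mu> moments] by (auto simp: convergent_def)
    have "(\<lambda>n. \<integral>x. f x \<partial>\<mu> (r n)) \<longlonglongrightarrow> (\<integral>x. f x \<partial>\<nu>)"
      using wc f by (simp add: weak_conv_on_def)
    moreover have "(\<lambda>n. \<integral>x. f x \<partial>\<mu> (r n)) \<longlonglongrightarrow> l"
      using LIMSEQ_subseq_LIMSEQ[OF l r] by (simp add: comp_def)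
    ultimately show "(\<lambda>n. \<integral>x. f x \<partial>\<mu> n) \<longlonglongrightarrow> (\<integral>x. f x \<partial>\<nu>)"
      using l LIMSEQ_unique by blast
  qed
  then show ?thesis using \<nu> by blast
qed

section \<open>Measurability of random measures through continuous test functions\<close>

text \<open>The integrands are continuous, equal to 1 on S, and 0 at any other point once k exceeds
  the reciprocal of its distance to S. For empty S the distance would be 0 and the integrands
  constantly 1.\<close>

lemma integral_tendsto_measure_closed:
  assumes G: "G \<in> probs" and S: "closed S" "S \<noteq> {}"
  shows "(\<lambda>k. \<integral>x. max 0 (1 - real k * infdist x S) \<partial>G) \<longlonglongrightarrow> measure G (\<Theta> \<inter> S)"
proof -
  interpret prob_space G using probsD[OF G] by simp
  have cont: "continuous_on \<Theta> (\<lambda>x. max 0 (1 - real k * infdist x S))" for k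
    by (intro continuous_intros)
  have S_meas: "\<Theta> \<inter> S \<in> sets G"
    using S(1) probsD(2)[OF G] by (auto simp: sets_restrict_space)
  have "(\<lambda>k. \<integral>x. max 0 (1 - real k * infdist x S) \<partial>G) \<longlonglongrightarrow> (\<integral>x. indicator (\<Theta> \<inter> S) x \<partial>G)"
  proof (rule integral_dominated_convergence[where w = "\<lambda>_. 1"])
    show "AE x in G. (\<lambda>k. max 0 (1 - real k * infdist x S)) \<longlonglongrightarrow> indicator (\<Theta> \<inter> S) x"
    proof (rule AE_I2)
      fix x assume x: "x \<in> space G"
      show "(\<lambda>k. max 0 (1 - real k * infdist x S)) \<longlonglongrightarrow> indicator (\<Theta> \<inter> S) x"
      proof (cases "x \<in> S")
        case True
        then show ?thesis using x probsD(3)[OF G] by simp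
      next
        case False
        then have pos: "0 < infdist x S"
          using S infdist_pos_not_in_closed by blast
        obtain K :: nat where K: "1 / infdist x S < real K"
          using reals_Archimedean2 by blast
        have "max 0 (1 - real k * infdist x S) = 0" if "k \<ge> K" for k
        proof -
          have "1 < real K * infdist x S"
            using K pos by (simp add: field_simps)
          also have "\<dots> \<le> real k * infdist x S"
            using that pos by (intro mult_right_mono) auto
          finally show ?thesis by simp
        qed
        then have "\<forall>\<^sub>F k in sequentially. max 0 (1 - real k * infdist x S) = 0"
          by (auto simp: eventually_sequentially)
        then show ?thesis
          using False by (simp add: tendsto_eventually)
      qed
    qed
    show "AE x in G. norm (max 0 (1 - real k * infdist x S)) \<le> 1" for k
      by (auto simp: infdist_nonneg)
    show "(\<lambda>x. max 0 (1 - real k * infdist x S)) \<in> borel_measurable G" for k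
      by (intro probsD(4)[OF G] continuous_measurable cont)
  qed (use S_meas in auto)
  then show ?thesis
    using S_meas by simp
qed

text \<open>Traces of closed sets on \<Theta> are a generator stable under intersection, so it
  suffices to measure those, and their measures are limits of integrals of continuous functions.
  This suits a kernel obtained by choice, of which only the integrals are under control.\<close>

theorem measurable_prob_algebra_continuous:
  assumes K: "\<And>\<omega>. \<omega> \<in> space M \<Longrightarrow> K \<omega> \<in> probs"
    and int: "\<And>f :: real \<Rightarrow> real. continuous_on \<Theta> f \<Longrightarrow> (\<lambda>\<omega>. \<integral>\<theta>. f \<theta> \<partial>K \<omega>) \<in> borel_measurable M"
  shows "K \<in> measurable M (prob_algebra (restrict_space borel \<Theta>))"
proof (rule measurable_prob_algebra_generated[where \<Omega> = \<Theta> and G = "(\<inter>) \<Theta> ` Collect closed"])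
  have "sets (restrict_space borel \<Theta>) = sets (restrict_space (sigma UNIV (Collect closed)) \<Theta>)"
    by (simp only: borel_eq_closed)
  also have "\<dots> = (\<inter>) \<Theta> ` sigma_sets UNIV (Collect closed)"
    by (simp add: sets_restrict_space)
  also have "\<dots> = sigma_sets \<Theta> ((\<inter>) \<Theta> ` Collect closed)"
    using compact_imp_closed[OF compact_support] by (intro sigma_sets_Int) auto
  finally show "sets (restrict_space borel \<Theta>) = sigma_sets \<Theta> ((\<inter>) \<Theta> ` Collect closed)" .
  show "Int_stable ((\<inter>) \<Theta> ` Collect closed)"
    unfolding Int_stable_def
  proof (intro ballI)
    fix a b assume "a \<in> (\<inter>) \<Theta> ` Collect closed" "b \<in> (\<inter>) \<Theta> ` Collect closed"
    then obtain A B where "closed A" "closed B" "a = \<Theta> \<inter> A" "b = \<Theta> \<inter> B" by auto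
    then show "a \<inter> b \<in> (\<inter>) \<Theta> ` Collect closed"
      by (intro image_eqI[where x = "A \<inter> B"]) auto
  qed
  fix A assume "A \<in> (\<inter>) \<Theta> ` Collect closed"
  then obtain S where S: "closed S" "A = \<Theta> \<inter> S" by auto
  have "(\<lambda>\<omega>. measure (K \<omega>) A) \<in> borel_measurable M"
  proof (cases "S = {}")
    case False
    show ?thesis
      unfolding S(2)
    proof (rule borel_measurable_LIMSEQ_real)
      show "(\<lambda>k. \<integral>x. max 0 (1 - real k * infdist x S) \<partial>K \<omega>) \<longlonglongrightarrow> measure (K \<omega>) (\<Theta> \<inter> S)"
        if "\<omega> \<in> space M" for \<omega>
        by (rule integral_tendsto_measure_closed[OF K[OF that] S(1) False])
      show "(\<lambda>\<omega>. \<integral>x. max 0 (1 - real k * infdist x S) \<partial>K \<omega>) \<in> borel_measurable M" for k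
        by (intro int continuous_intros)
    qed
  qed (simp add: S)
  then have "(\<lambda>\<omega>. ennreal (measure (K \<omega>) A)) \<in> borel_measurable M"
    by simp
  then show "(\<lambda>\<omega>. emeasure (K \<omega>) A) \<in> borel_measurable M"
    by (rule measurable_cong[THEN iffD1, rotated])
       (simp add: finite_measure.emeasure_eq_measure prob_space.finite_measure probsD(1) K)
qed (use K probsD in auto)

end

section \<open>Convergence of the learning model\<close>

text \<open>Induction on the length of the history: with the last value frozen at v, a function of
  the first n values remains, and the countably many v can be glued together. This gives
  measurability of functionals of \<open>newton\<close> without treating the update as a measurable
  map between spaces of measures.\<close>

lemma measurable_finite_history:
  fixes Y :: "nat \<Rightarrow> 'a \<Rightarrow> 'b :: countable"
  assumes "\<And>k. k \<in> {1..n} \<Longrightarrow> Y k \<in> measurable L (count_space UNIV)"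
    and "\<And>y y'. (\<And>k. k \<in> {1..n} \<Longrightarrow> y k = y' k) \<Longrightarrow> \<phi> y = \<phi> y'"
    and "\<And>y. \<phi> y \<in> space N"
  shows "(\<lambda>\<omega>. \<phi> (\<lambda>k. Y k \<omega>)) \<in> measurable L N"
  using assms
proof (induction n arbitrary: \<phi>)
  case 0
  have "\<phi> (\<lambda>k. Y k \<omega>) = \<phi> (\<lambda>_. undefined)" for \<omega>
    by (rule "0.prems"(2)) simp
  then show ?case
    using "0.prems"(3) by (simp add: measurable_const)
next
  case (Suc n)
  have "(\<lambda>\<omega>. \<phi> ((\<lambda>k. Y k \<omega>)(Suc n := v))) \<in> measurable L N" for v
  proof (rule Suc.IH[of "\<lambda>y. \<phi> (y(Suc n := v))"])
    fix y y' :: "nat \<Rightarrow> 'b" assume "\<And>k. k \<in> {1..n} \<Longrightarrow> y k = y' k"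
    then show "\<phi> (y(Suc n := v)) = \<phi> (y'(Suc n := v))"
      by (intro Suc.prems(2)) simp
  qed (use Suc.prems(1,3) in simp_all)
  moreover have "Y (Suc n) \<in> measurable L (count_space UNIV)"
    using Suc.prems(1) by simp
  ultimately have "(\<lambda>\<omega>. \<phi> ((\<lambda>k. Y k \<omega>)(Suc n := Y (Suc n) \<omega>))) \<in> measurable L N"
    by (rule measurable_compose_countable)
  then show ?case
    by (simp add: fun_upd_idem)
qed

lemma newton_cong:
  "(\<And>k. k \<in> {1..n} \<Longrightarrow> y k = y' k) \<Longrightarrow> newton G0 \<alpha> y n = newton G0 \<alpha> y' n"
  by (induction n) auto

locale newton_model = compact_positive_support \<Theta> + prob_space M
  for \<Theta> and M :: "'a measure" +
  fixes G0 \<alpha> and Y :: "nat \<Rightarrow> 'a \<Rightarrow> nat"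
  assumes G0_probs: "G0 \<in> probs"
    and rate: "n \<ge> 1 \<Longrightarrow> 0 < \<alpha> n \<and> \<alpha> n < 1"
    and rate_summable: "summable (\<lambda>n. (\<alpha> (Suc n))\<^sup>2)"
    and Y_measurable: "n \<ge> 1 \<Longrightarrow> Y n \<in> measurable M (count_space UNIV)"
    and predictive: "AE \<omega> in M.
      real_cond_exp M (nat_filtration M Y n) (\<lambda>\<omega>'. indicator {y} (Y (Suc n) \<omega>')) \<omega>
        = poisson_mixture (newton G0 \<alpha> (\<lambda>k. Y k \<omega>) n) y"
begin

abbreviation "F \<equiv> nat_filtration M Y"

definition G :: "nat \<Rightarrow> 'a \<Rightarrow> real measure" where
  "G n \<omega> = newton G0 \<alpha> (\<lambda>k. Y k \<omega>) n"

lemma G_probs: "G n \<omega> \<in> probs"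
  unfolding G_def by (rule newton_probs[OF G0_probs rate])

lemma G_Suc: "G (Suc n) \<omega> = newton_update (\<alpha> (Suc n)) (Y (Suc n) \<omega>) (G n \<omega>)"
  by (simp add: G_def)

lemma F_generators: "(\<Union>k\<in>{1..n}. {Y k -` A \<inter> space M | A. A \<in> sets (count_space UNIV)}) \<subseteq> Pow (space M)"
  by auto

lemma space_F: "space (F n) = space M"
  unfolding nat_filtration_def by (rule space_measure_of[OF F_generators])

lemma sets_F: "sets (F n) = sigma_sets (space M)
    (\<Union>k\<in>{1..n}. {Y k -` A \<inter> space M | A. A \<in> sets (count_space UNIV)})"
  unfolding nat_filtration_def by (rule sets_measure_of[OF F_generators])

lemma subalgebra_F: "subalgebra M (F n)"
  unfolding subalgebra_def
proof
  show "sets (F n) \<subseteq> sets M"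
    unfolding sets_F
  proof (rule sets.sigma_sets_subset, safe)
    fix k and A :: "nat set" assume "k \<in> {1..n}" "A \<in> sets (count_space UNIV)"
    then show "Y k -` A \<inter> space M \<in> sets M"
      using Y_measurable[of k] by (auto intro: measurable_sets)
  qed
qed (rule space_F)

lemma F_mono: "m \<le> n \<Longrightarrow> sets (F m) \<subseteq> sets (F n)"
  unfolding sets_F by (rule sigma_sets_subseteq, rule UN_mono) auto

lemma Y_measurable_F: "k \<in> {1..n} \<Longrightarrow> Y k \<in> measurable (F n) (count_space UNIV)"
  unfolding measurable_def space_F sets_F
  by (simp, intro allI sigma_sets.Basic UN_I[of k]) (simp, blast)

text \<open>An arbitrary \<open>h\<close> is allowed because \<open>G n\<close> takes at most one
  value for each of the countably many histories of length n.\<close>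

lemma G_functional_measurable:
  assumes "\<And>\<nu>. \<nu> \<in> probs \<Longrightarrow> h \<nu> \<in> space N"
  shows "(\<lambda>\<omega>. h (G n \<omega>)) \<in> measurable (F n) N"
  unfolding G_def
proof (rule measurable_finite_history[where n = n and \<phi> = "\<lambda>y. h (newton G0 \<alpha> y n)"])
  fix y y' :: "nat \<Rightarrow> nat" assume "\<And>k. k \<in> {1..n} \<Longrightarrow> y k = y' k"
  then show "h (newton G0 \<alpha> y n) = h (newton G0 \<alpha> y' n)"
    by (intro arg_cong[where f = h] newton_cong)
next
  fix y show "h (newton G0 \<alpha> y n) \<in> space N"
    by (rule assms[OF newton_probs[OF G0_probs rate]])
qed (rule Y_measurable_F)

lemma measurable_F_M: "f \<in> measurable (F n) N \<Longrightarrow> f \<in> measurable M N"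
  by (rule measurable_from_subalg[OF subalgebra_F])

lemma F_sigma_finite: "sigma_finite_subalgebra M (F n)"
  by (intro finite_measure_subalgebra_is_sigma_finite finite_measure_subalgebra.intro
      finite_measure_subalgebra_axioms.intro subalgebra_F finite_measure_axioms)

lemma poisson_mixture_measurable: "(\<lambda>\<omega>. poisson_mixture (G n \<omega>) y) \<in> borel_measurable (F n)"
  by (rule G_functional_measurable) simp

lemma poisson_mixture_le_1: "\<nu> \<in> probs \<Longrightarrow> \<bar>poisson_mixture \<nu> y\<bar> \<le> 1"
  unfolding poisson_mixture_def
  by (rule abs_integral_le_probs[OF _ poisson_measurable]) (simp_all add: pmf_le_1)

lemma indicator_Y_measurable:
  "n \<ge> 1 \<Longrightarrow> (\<lambda>\<omega>. indicator {y} (Y n \<omega>) :: real) \<in> borel_measurable M"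
  by (rule measurable_compose[OF Y_measurable]) auto

lemma integrable_bounded_real:
  fixes f :: "'a \<Rightarrow> real"
  assumes "f \<in> borel_measurable M" "\<And>\<omega>. \<omega> \<in> space M \<Longrightarrow> \<bar>f \<omega>\<bar> \<le> B"
  shows "integrable M f"
  by (rule integrable_const_bound[where B = B]) (use assms in auto)

section \<open>Martingales under the predictive law\<close>

text \<open>The predictive hypothesis in tested form; later arguments use it through this
  identity.\<close>

lemma expectation_indicator_Suc:
  assumes Z: "Z \<in> borel_measurable (F n)" and B: "\<And>\<omega>. \<omega> \<in> space M \<Longrightarrow> \<bar>Z \<omega>\<bar> \<le> B"
  shows "expectation (\<lambda>\<omega>. Z \<omega> * indicator {y} (Y (Suc n) \<omega>))
    = expectation (\<lambda>\<omega>. Z \<omega> * poisson_mixture (G n \<omega>) y)"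
proof -
  interpret S: sigma_finite_subalgebra M "F n" by (rule F_sigma_finite)
  have ind: "(\<lambda>\<omega>. indicator {y} (Y (Suc n) \<omega>) :: real) \<in> borel_measurable M"
    by (rule indicator_Y_measurable) simp
  have ZM: "Z \<in> borel_measurable M" by (rule measurable_F_M[OF Z])
  have "integrable M (\<lambda>\<omega>. Z \<omega> * indicator {y} (Y (Suc n) \<omega>))"
    using B by (intro integrable_bounded_real[where B = B] borel_measurable_times ZM ind)
      (auto simp: indicator_def intro: order_trans[OF abs_ge_zero])
  from S.real_cond_exp_intg(2)[OF this Z ind]
  have "expectation (\<lambda>\<omega>. Z \<omega> * indicator {y} (Y (Suc n) \<omega>))
      = expectation (\<lambda>\<omega>. Z \<omega> * real_cond_exp M (F n) (\<lambda>\<omega>. indicator {y} (Y (Suc n) \<omega>)) \<omega>)"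
    by simp
  also have "\<dots> = expectation (\<lambda>\<omega>. Z \<omega> * poisson_mixture (G n \<omega>) y)"
  proof (rule integral_cong_AE)
    show "AE \<omega> in M. Z \<omega> * real_cond_exp M (F n) (\<lambda>\<omega>. indicator {y} (Y (Suc n) \<omega>)) \<omega>
        = Z \<omega> * poisson_mixture (G n \<omega>) y"
      using predictive[of n y] by eventually_elim (simp add: G_def)
  qed (auto intro!: borel_measurable_times ZM measurable_F_M[OF poisson_mixture_measurable])
  finally show ?thesis .
qed

text \<open>The bound 2 is the triangle inequality for two terms of size at most 1. That it does not
  depend on n is what \<open>AE_mean_tendsto_0\<close> requires.\<close>

lemma predictive_error_martingale_difference:
  "bounded_martingale_difference M F
    (\<lambda>n \<omega>. indicator {y} (Y (Suc n) \<omega>) - poisson_mixture (G n \<omega>) y) (\<lambda>n. 2)"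
proof unfold_locales
  fix n
  show "(\<lambda>\<omega>. indicator {y} (Y (Suc n) \<omega>) - poisson_mixture (G n \<omega>) y) \<in> borel_measurable (F (Suc n))"
  proof (intro borel_measurable_diff)
    show "(\<lambda>\<omega>. indicator {y} (Y (Suc n) \<omega>) :: real) \<in> borel_measurable (F (Suc n))"
      by (rule measurable_compose[OF Y_measurable_F]) auto
    show "(\<lambda>\<omega>. poisson_mixture (G n \<omega>) y) \<in> borel_measurable (F (Suc n))"
      by (rule measurable_from_subalg[OF _ poisson_mixture_measurable])
         (use F_mono[of n "Suc n"] in \<open>simp add: subalgebra_def space_F\<close>)
  qed
next
  fix n \<omega>
  show "\<bar>indicator {y} (Y (Suc n) \<omega>) - poisson_mixture (G n \<omega>) y\<bar> \<le> 2"
    using poisson_mixture_le_1[OF G_probs, of n \<omega> y] by (auto simp: indicator_def)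
next
  fix Z :: "'a \<Rightarrow> real" and n B
  assume Z: "Z \<in> borel_measurable (F n)" and B: "\<And>\<omega>. \<omega> \<in> space M \<Longrightarrow> \<bar>Z \<omega>\<bar> \<le> B"
  have ZM: "Z \<in> borel_measurable M" by (rule measurable_F_M[OF Z])
  have "integrable M (\<lambda>\<omega>. Z \<omega> * indicator {y} (Y (Suc n) \<omega>))"
    using B by (intro integrable_bounded_real[where B = B] borel_measurable_times ZM indicator_Y_measurable)
      (auto simp: indicator_def intro: order_trans[OF abs_ge_zero])
  moreover have "integrable M (\<lambda>\<omega>. Z \<omega> * poisson_mixture (G n \<omega>) y)"
  proof (rule integrable_bounded_real)
    show "\<bar>Z \<omega> * poisson_mixture (G n \<omega>) y\<bar> \<le> B * 1" if "\<omega> \<in> space M" for \<omega>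
      unfolding abs_mult using B[OF that] poisson_mixture_le_1[OF G_probs]
      by (intro mult_mono) auto
  qed (intro borel_measurable_times ZM measurable_F_M[OF poisson_mixture_measurable])
  ultimately show "expectation (\<lambda>\<omega>. Z \<omega> * (indicator {y} (Y (Suc n) \<omega>) - poisson_mixture (G n \<omega>) y)) = 0"
    using expectation_indicator_Suc[OF Z B] by (simp add: right_diff_distrib)
qed (use subalgebra_F F_mono in auto)

lemma integral_measurable_F: "(\<lambda>\<omega>. \<integral>\<theta>. f \<theta> \<partial>G n \<omega> :: real) \<in> borel_measurable (F n)"
  by (rule G_functional_measurable) simp

text \<open>The increment is the learning rate times the posterior mean minus the current mean, each
  at most C in size; hence \<open>2 * C\<close>. Weighted by the predictive probabilities, the
  posterior means sum to the current mean and the weights to 1, so the average increment is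
  0.\<close>

lemma integral_increment_martingale_difference:
  assumes f: "f \<in> borel_measurable (restrict_space borel \<Theta>)"
    and f_le: "\<And>\<theta>. \<theta> \<in> \<Theta> \<Longrightarrow> \<bar>f \<theta>\<bar> \<le> C"
  shows "bounded_martingale_difference M F
    (\<lambda>n \<omega>. (\<integral>\<theta>. f \<theta> \<partial>G (Suc n) \<omega>) - (\<integral>\<theta>. f \<theta> \<partial>G n \<omega>)) (\<lambda>n. \<alpha> (Suc n) * (2 * C))"
proof -
  define \<phi> where "\<phi> n \<omega> = (\<integral>\<theta>. f \<theta> \<partial>G n \<omega>)" for n \<omega>
  define \<psi> where "\<psi> n \<omega> y = (\<integral>\<theta>. f \<theta> * pmf (poisson_pmf \<theta>) y \<partial>G n \<omega>)" for n \<omega> y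
  \<comment> \<open>\<open>D n \<omega> y\<close> is the increment that observing y would cause. It
    depends on the past alone, so it can join the test variable.\<close>
  define D where "D n \<omega> y = \<alpha> (Suc n) * (\<psi> n \<omega> y / poisson_mixture (G n \<omega>) y - \<phi> n \<omega>)" for n \<omega> y
  have incr: "\<phi> (Suc n) \<omega> - \<phi> n \<omega> = D n \<omega> (Y (Suc n) \<omega>)" for n \<omega>
    using rate[of "Suc n"] integral_newton_update[OF G_probs _ _ f f_le, of "\<alpha> (Suc n)" "Y (Suc n) \<omega>" n \<omega>]
    unfolding \<phi>_def \<psi>_def D_def G_Suc by (simp add: algebra_simps)
  have \<phi>_le: "\<bar>\<phi> n \<omega>\<bar> \<le> C" for n \<omega>
    unfolding \<phi>_def by (rule abs_integral_le_probs[OF G_probs f f_le])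
  have p_pos: "0 < poisson_mixture (G n \<omega>) y" for n \<omega> y
    by (rule poisson_mixture_pos[OF G_probs])
  have \<psi>_le: "\<bar>\<psi> n \<omega> y / poisson_mixture (G n \<omega>) y\<bar> \<le> C" for n \<omega> y
    using abs_integral_poisson_le[OF G_probs f f_le, of n \<omega> y] p_pos[of n \<omega> y]
    by (simp add: \<psi>_def abs_divide field_simps)
  have D_le: "\<bar>D n \<omega> y\<bar> \<le> \<alpha> (Suc n) * (2 * C)" for n \<omega> y
    unfolding D_def abs_mult
    using abs_triangle_ineq4[of "\<psi> n \<omega> y / poisson_mixture (G n \<omega>) y" "\<phi> n \<omega>"]
      \<psi>_le[of n \<omega> y] \<phi>_le[of n \<omega>] rate[of "Suc n"] by (intro mult_mono) linarith+
  have D_meas: "(\<lambda>\<omega>. D n \<omega> y) \<in> borel_measurable (F n)" for n y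
    unfolding D_def \<phi>_def \<psi>_def by (rule G_functional_measurable) simp
  have \<phi>_meas: "\<phi> n \<in> borel_measurable (F n)" for n
    unfolding \<phi>_def by (rule integral_measurable_F)
  have "bounded_martingale_difference M F (\<lambda>n \<omega>. \<phi> (Suc n) \<omega> - \<phi> n \<omega>) (\<lambda>n. \<alpha> (Suc n) * (2 * C))"
  proof unfold_locales
    fix n
    show "(\<lambda>\<omega>. \<phi> (Suc n) \<omega> - \<phi> n \<omega>) \<in> borel_measurable (F (Suc n))"
    proof (intro borel_measurable_diff \<phi>_meas)
      show "\<phi> n \<in> borel_measurable (F (Suc n))"
        by (rule measurable_from_subalg[OF _ \<phi>_meas])
           (use F_mono[of n "Suc n"] in \<open>simp add: subalgebra_def space_F\<close>)
    qed
  next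
    fix n \<omega> show "\<bar>\<phi> (Suc n) \<omega> - \<phi> n \<omega>\<bar> \<le> \<alpha> (Suc n) * (2 * C)"
      unfolding incr by (rule D_le)
  next
    fix Z :: "'a \<Rightarrow> real" and n B
    assume Z: "Z \<in> borel_measurable (F n)" and B: "\<And>\<omega>. \<omega> \<in> space M \<Longrightarrow> \<bar>Z \<omega>\<bar> \<le> B"
    let ?p = "\<lambda>\<omega> y. poisson_mixture (G n \<omega>) y"
    let ?K = "\<alpha> (Suc n) * (2 * C)"
    have ZD_meas: "(\<lambda>\<omega>. Z \<omega> * D n \<omega> y) \<in> borel_measurable (F n)" for y
      by (intro borel_measurable_times Z D_meas)
    have ZD_le: "\<bar>Z \<omega> * D n \<omega> y\<bar> \<le> B * ?K" if "\<omega> \<in> space M" for \<omega> y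
      unfolding abs_mult using B[OF that] D_le by (intro mult_mono) auto
    \<comment> \<open>The product bounds an absolute value at some point of the nonempty sample
      space.\<close>
    have BK: "0 \<le> B * ?K"
      using not_empty order_trans[OF abs_ge_zero ZD_le] by blast
    have Y_meas: "(\<lambda>\<omega>. indicator {y} (Y (Suc n) \<omega>) :: real) \<in> borel_measurable M" for y
      by (rule indicator_Y_measurable) simp
    have XM: "(\<lambda>\<omega>. D n \<omega> (Y (Suc n) \<omega>)) \<in> borel_measurable M"
      using Y_measurable[of "Suc n"] by (intro measurable_compose_countable[OF measurable_F_M[OF D_meas]]) auto
    \<comment> \<open>For finitely many y each indicator may be replaced by its predictive
      probability. The next two limits remove the cutoff N on either side.\<close>
    have trunc: "expectation (\<lambda>\<omega>. \<Sum>y<N. (Z \<omega> * D n \<omega> y) * indicator {y} (Y (Suc n) \<omega>))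
        = expectation (\<lambda>\<omega>. \<Sum>y<N. (Z \<omega> * D n \<omega> y) * ?p \<omega> y)" for N
    proof -
      have i1: "integrable M (\<lambda>\<omega>. (Z \<omega> * D n \<omega> y) * indicator {y} (Y (Suc n) \<omega>))" for y
      proof (rule integrable_bounded_real)
        show "\<bar>(Z \<omega> * D n \<omega> y) * indicator {y} (Y (Suc n) \<omega>)\<bar> \<le> (B * ?K) * 1" if "\<omega> \<in> space M" for \<omega>
          unfolding abs_mult[of "Z \<omega> * D n \<omega> y"]
          using ZD_le[OF that, of y] BK
          by (intro mult_mono) (auto simp: indicator_def)
      qed (intro borel_measurable_times[OF measurable_F_M[OF ZD_meas] Y_meas])
      have i2: "integrable M (\<lambda>\<omega>. (Z \<omega> * D n \<omega> y) * ?p \<omega> y)" for y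
      proof (rule integrable_bounded_real)
        show "\<bar>(Z \<omega> * D n \<omega> y) * ?p \<omega> y\<bar> \<le> (B * ?K) * 1" if "\<omega> \<in> space M" for \<omega>
          unfolding abs_mult[of "Z \<omega> * D n \<omega> y"]
          using ZD_le[OF that, of y] BK poisson_mixture_le_1[OF G_probs]
          by (intro mult_mono) auto
      qed (intro borel_measurable_times[OF measurable_F_M[OF ZD_meas] measurable_F_M[OF poisson_mixture_measurable]])
      show ?thesis
        by (simp only: Bochner_Integration.integral_sum i1 i2 expectation_indicator_Suc[OF ZD_meas ZD_le])
    qed
    have lhs: "(\<lambda>N. expectation (\<lambda>\<omega>. \<Sum>y<N. (Z \<omega> * D n \<omega> y) * indicator {y} (Y (Suc n) \<omega>)))
        \<longlonglongrightarrow> expectation (\<lambda>\<omega>. Z \<omega> * D n \<omega> (Y (Suc n) \<omega>))"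
    proof (rule integral_dominated_convergence[where w = "\<lambda>_. B * ?K"])
      \<comment> \<open>At most the term with y equal to the actual observation survives, and it
        appears once N exceeds that observation.\<close>
      have eq: "(\<Sum>y<N. (Z \<omega> * D n \<omega> y) * indicator {y} (Y (Suc n) \<omega>))
          = (if Y (Suc n) \<omega> < N then Z \<omega> * D n \<omega> (Y (Suc n) \<omega>) else 0)" for N \<omega>
        by (simp add: indicator_def sum.delta' if_distrib[of "\<lambda>x. _ * x"] cong: if_cong)
      show "AE \<omega> in M. (\<lambda>N. \<Sum>y<N. (Z \<omega> * D n \<omega> y) * indicator {y} (Y (Suc n) \<omega>))
          \<longlonglongrightarrow> Z \<omega> * D n \<omega> (Y (Suc n) \<omega>)"
        unfolding eq
        by (intro AE_I2 tendsto_eventually eventually_mono[OF eventually_gt_at_top]) auto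
      show "AE \<omega> in M. norm (\<Sum>y<N. (Z \<omega> * D n \<omega> y) * indicator {y} (Y (Suc n) \<omega>)) \<le> B * ?K" for N
        unfolding eq using ZD_le BK by (intro AE_I2) auto
      show "(\<lambda>\<omega>. \<Sum>y<N. (Z \<omega> * D n \<omega> y) * indicator {y} (Y (Suc n) \<omega>)) \<in> borel_measurable M" for N
        by (intro borel_measurable_sum borel_measurable_times[OF measurable_F_M[OF ZD_meas] Y_meas])
      show "(\<lambda>\<omega>. Z \<omega> * D n \<omega> (Y (Suc n) \<omega>)) \<in> borel_measurable M"
        by (intro borel_measurable_times measurable_F_M[OF Z] XM)
    qed simp
    have rhs: "(\<lambda>N. expectation (\<lambda>\<omega>. \<Sum>y<N. (Z \<omega> * D n \<omega> y) * ?p \<omega> y)) \<longlonglongrightarrow> expectation (\<lambda>\<omega>. 0)"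
    proof (rule integral_dominated_convergence[where w = "\<lambda>_. B * ?K"])
      \<comment> \<open>Multiplying by the predictive probability cancels the denominator inside
        D.\<close>
      have eq: "(\<Sum>y<N. (Z \<omega> * D n \<omega> y) * ?p \<omega> y)
          = Z \<omega> * (\<alpha> (Suc n) * ((\<Sum>y<N. \<psi> n \<omega> y) - (\<Sum>y<N. ?p \<omega> y) * \<phi> n \<omega>))" for N \<omega>
      proof -
        have *: "(Z \<omega> * D n \<omega> y) * ?p \<omega> y = Z \<omega> * (\<alpha> (Suc n) * (\<psi> n \<omega> y - ?p \<omega> y * \<phi> n \<omega>))" for y
          using p_pos[of n \<omega> y] by (simp add: D_def field_simps)
        show ?thesis
          by (simp only: * sum_subtractf flip: sum_distrib_left sum_distrib_right)
      qed
      show "AE \<omega> in M. (\<lambda>N. \<Sum>y<N. (Z \<omega> * D n \<omega> y) * ?p \<omega> y) \<longlonglongrightarrow> 0"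
      proof (rule AE_I2)
        fix \<omega>
        interpret Gn: prob_space "G n \<omega>" by (rule probsD(1)[OF G_probs])
        have "(\<lambda>N. \<Sum>y<N. \<psi> n \<omega> y) \<longlonglongrightarrow> \<phi> n \<omega>"
          unfolding \<psi>_def \<phi>_def by (rule sum_integral_poisson_tendsto[OF G_probs f f_le])
        moreover have "(\<lambda>N. \<Sum>y<N. ?p \<omega> y) \<longlonglongrightarrow> 1"
          using sum_integral_poisson_tendsto[OF G_probs[of n \<omega>], of "\<lambda>_. 1" 1] Gn.prob_space
          by (simp add: poisson_mixture_def)
        ultimately have "(\<lambda>N. Z \<omega> * (\<alpha> (Suc n) * ((\<Sum>y<N. \<psi> n \<omega> y) - (\<Sum>y<N. ?p \<omega> y) * \<phi> n \<omega>)))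
            \<longlonglongrightarrow> Z \<omega> * (\<alpha> (Suc n) * (\<phi> n \<omega> - 1 * \<phi> n \<omega>))"
          by (intro tendsto_intros)
        then show "(\<lambda>N. \<Sum>y<N. (Z \<omega> * D n \<omega> y) * ?p \<omega> y) \<longlonglongrightarrow> 0"
          unfolding eq by simp
      qed
      show "AE \<omega> in M. norm (\<Sum>y<N. (Z \<omega> * D n \<omega> y) * ?p \<omega> y) \<le> B * ?K" for N
      proof (rule AE_I2)
        fix \<omega> assume \<omega>: "\<omega> \<in> space M"
        \<comment> \<open>The mixture weights below N sum to at most 1, so one bound serves for all
          N.\<close>
        have "\<bar>\<Sum>y<N. (Z \<omega> * D n \<omega> y) * ?p \<omega> y\<bar> \<le> (\<Sum>y<N. (B * ?K) * ?p \<omega> y)"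
          using ZD_le[OF \<omega>] p_pos
          by (intro order_trans[OF sum_abs sum_mono])
             (auto simp: abs_mult[of "Z \<omega> * D n \<omega> _"] less_imp_le intro!: mult_right_mono)
        also have "\<dots> \<le> (B * ?K) * 1"
          unfolding sum_distrib_left[symmetric]
          using BK sum_poisson_mixture_le_1[OF G_probs]
          by (intro mult_left_mono) auto
        finally show "norm (\<Sum>y<N. (Z \<omega> * D n \<omega> y) * ?p \<omega> y) \<le> B * ?K" by simp
      qed
      show "(\<lambda>\<omega>. \<Sum>y<N. (Z \<omega> * D n \<omega> y) * ?p \<omega> y) \<in> borel_measurable M" for N
        by (intro borel_measurable_sum
            borel_measurable_times[OF measurable_F_M[OF ZD_meas] measurable_F_M[OF poisson_mixture_measurable]])
    qed simp_all
    have "expectation (\<lambda>\<omega>. Z \<omega> * D n \<omega> (Y (Suc n) \<omega>)) = expectation (\<lambda>\<omega>. 0)"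
      by (rule LIMSEQ_unique[OF lhs]) (use rhs trunc in simp)
    then show "expectation (\<lambda>\<omega>. Z \<omega> * (\<phi> (Suc n) \<omega> - \<phi> n \<omega>)) = 0"
      unfolding incr by simp
  qed (use subalgebra_F F_mono in auto)
  then show ?thesis
    unfolding \<phi>_def .
qed

text \<open>A test variable known at time n is known at every later time, hence orthogonal to each
  increment between n and m.\<close>

lemma expectation_integral_eq:
  fixes f :: "real \<Rightarrow> real"
  assumes f: "f \<in> borel_measurable (restrict_space borel \<Theta>)" "\<And>\<theta>. \<theta> \<in> \<Theta> \<Longrightarrow> \<bar>f \<theta>\<bar> \<le> C"
    and Z: "Z \<in> borel_measurable (F n)" and B: "\<And>\<omega>. \<omega> \<in> space M \<Longrightarrow> \<bar>Z \<omega>\<bar> \<le> B"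
    and "n \<le> m"
  shows "expectation (\<lambda>\<omega>. Z \<omega> * (\<integral>\<theta>. f \<theta> \<partial>G m \<omega>)) = expectation (\<lambda>\<omega>. Z \<omega> * (\<integral>\<theta>. f \<theta> \<partial>G n \<omega>))"
  using \<open>n \<le> m\<close>
proof (induction m rule: dec_induct)
  case (step m)
  interpret D: bounded_martingale_difference M F
    "\<lambda>n \<omega>. (\<integral>\<theta>. f \<theta> \<partial>G (Suc n) \<omega>) - (\<integral>\<theta>. f \<theta> \<partial>G n \<omega>)" "\<lambda>n. \<alpha> (Suc n) * (2 * C)"
    by (rule integral_increment_martingale_difference[OF f])
  have int: "integrable M (\<lambda>\<omega>. Z \<omega> * (\<integral>\<theta>. f \<theta> \<partial>G k \<omega>))" for k
  proof (rule integrable_bounded_real)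
    show "\<bar>Z \<omega> * (\<integral>\<theta>. f \<theta> \<partial>G k \<omega>)\<bar> \<le> B * C" if "\<omega> \<in> space M" for \<omega>
      unfolding abs_mult
      using B[OF that] abs_integral_le_probs[OF G_probs f] by (intro mult_mono) auto
  qed (intro borel_measurable_times measurable_F_M[OF Z] measurable_F_M[OF integral_measurable_F])
  have "expectation (\<lambda>\<omega>. Z \<omega> * ((\<integral>\<theta>. f \<theta> \<partial>G (Suc m) \<omega>) - (\<integral>\<theta>. f \<theta> \<partial>G m \<omega>))) = 0"
    by (rule D.orthogonal[OF D.measurable_F_mono[OF Z step.hyps(1)] B])
  then show ?case
    using step.IH int by (simp add: right_diff_distrib)
qed simp

lemma AE_convergent_integral:
  fixes f :: "real \<Rightarrow> real"
  assumes f: "f \<in> borel_measurable (restrict_space borel \<Theta>)" "\<And>\<theta>. \<theta> \<in> \<Theta> \<Longrightarrow> \<bar>f \<theta>\<bar> \<le> C"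
  shows "AE \<omega> in M. convergent (\<lambda>n. \<integral>\<theta>. f \<theta> \<partial>G n \<omega>)"
proof -
  interpret D: bounded_martingale_difference M F
    "\<lambda>n \<omega>. (\<integral>\<theta>. f \<theta> \<partial>G (Suc n) \<omega>) - (\<integral>\<theta>. f \<theta> \<partial>G n \<omega>)" "\<lambda>n. \<alpha> (Suc n) * (2 * C)"
    by (rule integral_increment_martingale_difference[OF f])
  have "summable (\<lambda>n. (\<alpha> (Suc n) * (2 * C))\<^sup>2)"
    unfolding power_mult_distrib[of "\<alpha> _"] by (rule summable_mult2[OF rate_summable])
  from D.AE_summable[OF this] show ?thesis
  proof eventually_elim
    case (elim \<omega>)
    then have "convergent (\<lambda>n. (\<integral>\<theta>. f \<theta> \<partial>G n \<omega>) - (\<integral>\<theta>. f \<theta> \<partial>G 0 \<omega>))"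
      by (simp only: summable_iff_convergent
          sum_lessThan_telescope[of "\<lambda>n. \<integral>\<theta>. f \<theta> \<partial>G n \<omega>"])
    then have "convergent (\<lambda>n. ((\<integral>\<theta>. f \<theta> \<partial>G n \<omega>) - (\<integral>\<theta>. f \<theta> \<partial>G 0 \<omega>)) + (\<integral>\<theta>. f \<theta> \<partial>G 0 \<omega>))"
      by (intro convergent_add convergent_const)
    then show ?case by simp
  qed
qed

section \<open>The random limit measure\<close>

text \<open>A single event of full probability that serves all continuous test functions at once. It
  is measurable, by the Cauchy criterion, so definitions may split on it.\<close>

definition moments_converge :: "'a \<Rightarrow> bool" where
  "moments_converge \<omega> \<longleftrightarrow> (\<forall>j. convergent (\<lambda>n. \<integral>\<theta>. \<theta> ^ j \<partial>G n \<omega>))"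

text \<open>The default \<open>G0\<close> makes this a probability measure on \<Theta> at every
  outcome, as a measurable map into \<open>prob_algebra\<close> requires.\<close>

definition G_lim :: "'a \<Rightarrow> real measure" where
  "G_lim \<omega> = (if moments_converge \<omega>
    then SOME \<nu>. \<nu> \<in> probs \<and> weak_conv_on \<Theta> (\<lambda>n. G n \<omega>) \<nu> else G0)"

lemma AE_moments_converge: "AE \<omega> in M. moments_converge \<omega>"
  unfolding moments_converge_def
proof (subst AE_all_countable, intro allI)
  fix j :: nat
  have cont: "continuous_on \<Theta> (\<lambda>\<theta>. \<theta> ^ j)"
    by (intro continuous_intros)
  then obtain C where "\<And>\<theta>. \<theta> \<in> \<Theta> \<Longrightarrow> \<bar>\<theta> ^ j\<bar> \<le> C"
    using continuous_bounded by metis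
  then show "AE \<omega> in M. convergent (\<lambda>n. \<integral>\<theta>. \<theta> ^ j \<partial>G n \<omega>)"
    by (intro AE_convergent_integral continuous_measurable[OF cont])
qed

lemma moments_converge_measurable: "Measurable.pred M moments_converge"
proof -
  have "Measurable.pred M (\<lambda>\<omega>. Cauchy (\<lambda>n. \<integral>\<theta>. \<theta> ^ j \<partial>G n \<omega>))" for j
    using sets_Collect_Cauchy[of "\<lambda>n \<omega>. \<integral>\<theta>. \<theta> ^ j \<partial>G n \<omega>" M] measurable_F_M[OF integral_measurable_F]
    by (simp add: pred_def)
  then show ?thesis
    unfolding moments_converge_def Cauchy_convergent_iff by (intro pred_intros_countable)
qed

lemma G_lim_weak_limit:
  assumes "moments_converge \<omega>"
  shows "G_lim \<omega> \<in> probs" "weak_conv_on \<Theta> (\<lambda>n. G n \<omega>) (G_lim \<omega>)"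
proof -
  have "\<exists>\<nu>. \<nu> \<in> probs \<and> weak_conv_on \<Theta> (\<lambda>n. G n \<omega>) \<nu>"
    using ex_weak_limit[of "\<lambda>n. G n \<omega>"] G_probs assms by (auto simp: moments_converge_def)
  from someI_ex[OF this] show "G_lim \<omega> \<in> probs" "weak_conv_on \<Theta> (\<lambda>n. G n \<omega>) (G_lim \<omega>)"
    using assms by (auto simp: G_lim_def)
qed

lemma G_lim_probs: "G_lim \<omega> \<in> probs"
  using G_lim_weak_limit(1)[of \<omega>] G0_probs by (cases "moments_converge \<omega>") (auto simp: G_lim_def)

lemma integral_tendsto_G_lim:
  assumes "moments_converge \<omega>" and f: "continuous_on \<Theta> f"
  shows "(\<lambda>n. \<integral>\<theta>. f \<theta> \<partial>G n \<omega>) \<longlonglongrightarrow> (\<integral>\<theta>. f \<theta> \<partial>G_lim \<omega> :: real)"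
  using G_lim_weak_limit(2)[OF assms(1)] f
    compact_imp_bounded[OF compact_continuous_image[OF f compact_support]]
  by (simp add: weak_conv_on_def)

theorem G_lim_measurable: "G_lim \<in> measurable M (prob_algebra (restrict_space borel \<Theta>))"
proof (rule measurable_prob_algebra_continuous)
  fix f :: "real \<Rightarrow> real" assume f: "continuous_on \<Theta> f"
  show "(\<lambda>\<omega>. \<integral>\<theta>. f \<theta> \<partial>G_lim \<omega>) \<in> borel_measurable M"
  proof (rule borel_measurable_LIMSEQ_real)
    \<comment> \<open>Off the good event the approximants are set to the constant integral against
      \<open>G0\<close>, so that they converge at every outcome and not just almost surely.\<close>
    show "(\<lambda>n. if moments_converge \<omega> then \<integral>\<theta>. f \<theta> \<partial>G n \<omega> else \<integral>\<theta>. f \<theta> \<partial>G0)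
        \<longlonglongrightarrow> (\<integral>\<theta>. f \<theta> \<partial>G_lim \<omega>)" for \<omega>
      using integral_tendsto_G_lim[OF _ f, of \<omega>] by (cases "moments_converge \<omega>") (auto simp: G_lim_def)
    show "(\<lambda>\<omega>. if moments_converge \<omega> then \<integral>\<theta>. f \<theta> \<partial>G n \<omega> else \<integral>\<theta>. f \<theta> \<partial>G0) \<in> borel_measurable M" for n
      by (intro measurable_If measurable_F_M[OF integral_measurable_F] predE[OF moments_converge_measurable]) simp
  qed
qed (rule G_lim_probs)

lemma poisson_mixture_tendsto:
  "moments_converge \<omega> \<Longrightarrow> (\<lambda>n. poisson_mixture (G n \<omega>) y) \<longlonglongrightarrow> poisson_mixture (G_lim \<omega>) y"
  unfolding poisson_mixture_def by (rule integral_tendsto_G_lim[OF _ poisson_continuous])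

lemma poisson_mixture_lim_measurable: "(\<lambda>\<omega>. poisson_mixture (G_lim \<omega>) y) \<in> borel_measurable M"
proof (rule borel_measurable_LIMSEQ_real)
  show "(\<lambda>n. if moments_converge \<omega> then poisson_mixture (G n \<omega>) y else poisson_mixture G0 y)
      \<longlonglongrightarrow> poisson_mixture (G_lim \<omega>) y" for \<omega>
    using poisson_mixture_tendsto[of \<omega>] by (cases "moments_converge \<omega>") (auto simp: G_lim_def)
  show "(\<lambda>\<omega>. if moments_converge \<omega> then poisson_mixture (G n \<omega>) y else poisson_mixture G0 y) \<in> borel_measurable M" for n
    by (intro measurable_If measurable_F_M[OF poisson_mixture_measurable] predE[OF moments_converge_measurable]) simp
qed

section \<open>Conditional laws and empirical frequencies\<close>

lemma expectation_poisson_mixture_eq: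
  assumes "Z \<in> borel_measurable (F n)" "\<And>\<omega>. \<omega> \<in> space M \<Longrightarrow> \<bar>Z \<omega>\<bar> \<le> B" "n \<le> m"
  shows "expectation (\<lambda>\<omega>. Z \<omega> * poisson_mixture (G m \<omega>) y)
    = expectation (\<lambda>\<omega>. Z \<omega> * poisson_mixture (G n \<omega>) y)"
  unfolding poisson_mixture_def
  by (rule expectation_integral_eq[OF poisson_measurable _ assms, where C = 1]) (simp add: pmf_le_1)

text \<open>The tested expectations are constant in m from n on, while dominated convergence sends
  them to the expectation at the limit.\<close>

lemma expectation_poisson_mixture_lim:
  assumes Z: "Z \<in> borel_measurable (F n)" and B: "\<And>\<omega>. \<omega> \<in> space M \<Longrightarrow> \<bar>Z \<omega>\<bar> \<le> B"
  shows "expectation (\<lambda>\<omega>. Z \<omega> * poisson_mixture (G_lim \<omega>) y)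
    = expectation (\<lambda>\<omega>. Z \<omega> * poisson_mixture (G n \<omega>) y)"
proof (rule LIMSEQ_unique)
  show "(\<lambda>m. expectation (\<lambda>\<omega>. Z \<omega> * poisson_mixture (G m \<omega>) y))
      \<longlonglongrightarrow> expectation (\<lambda>\<omega>. Z \<omega> * poisson_mixture (G_lim \<omega>) y)"
  proof (rule integral_dominated_convergence[where w = "\<lambda>_. B * 1"])
    show "AE \<omega> in M. (\<lambda>m. Z \<omega> * poisson_mixture (G m \<omega>) y) \<longlonglongrightarrow> Z \<omega> * poisson_mixture (G_lim \<omega>) y"
      using AE_moments_converge by eventually_elim (intro tendsto_mult tendsto_const poisson_mixture_tendsto)
    show "AE \<omega> in M. norm (Z \<omega> * poisson_mixture (G m \<omega>) y) \<le> B * 1" for m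
      unfolding real_norm_def abs_mult
      using B poisson_mixture_le_1[OF G_probs] by (intro AE_I2 mult_mono) (auto intro: order_trans[OF abs_ge_zero])
  qed (auto intro!: borel_measurable_times measurable_F_M[OF Z] measurable_F_M[OF poisson_mixture_measurable]
      poisson_mixture_lim_measurable)
  show "(\<lambda>m. expectation (\<lambda>\<omega>. Z \<omega> * poisson_mixture (G m \<omega>) y))
      \<longlonglongrightarrow> expectation (\<lambda>\<omega>. Z \<omega> * poisson_mixture (G n \<omega>) y)"
    by (intro tendsto_eventually eventually_mono[OF eventually_ge_at_top[of n]]
        expectation_poisson_mixture_eq[OF Z B])
qed

text \<open>A tower argument: at time n + k - 1 the indicator is replaced by the mixture, which the
  martingale property carries back to time n.\<close>

lemma expectation_indicator_future:
  assumes Z: "Z \<in> borel_measurable (F n)" and B: "\<And>\<omega>. \<omega> \<in> space M \<Longrightarrow> \<bar>Z \<omega>\<bar> \<le> B" and "k \<ge> 1"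
  shows "expectation (\<lambda>\<omega>. Z \<omega> * indicator {y} (Y (n + k) \<omega>))
    = expectation (\<lambda>\<omega>. Z \<omega> * poisson_mixture (G n \<omega>) y)"
proof -
  obtain j where k: "k = Suc j"
    using \<open>k \<ge> 1\<close> by (cases k) auto
  have "Z \<in> borel_measurable (F (n + j))"
    by (rule measurable_from_subalg[OF _ Z])
       (use F_mono[of n "n + j"] in \<open>simp add: subalgebra_def space_F\<close>)
  from expectation_indicator_Suc[OF this B] show ?thesis
    using expectation_poisson_mixture_eq[OF Z B, of "n + j"] by (simp add: k)
qed

text \<open>Indicators of sets in \<open>F n\<close> are admissible test variables, and they
  characterise the conditional expectation. Here f will be the future indicator and the limit
  mixture, which thus share one version.\<close>

lemma real_cond_exp_eq_poisson_mixture: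
  assumes f: "integrable M f"
    and eq: "\<And>Z. Z \<in> borel_measurable (F n) \<Longrightarrow> (\<And>\<omega>. \<omega> \<in> space M \<Longrightarrow> \<bar>Z \<omega>\<bar> \<le> 1) \<Longrightarrow>
      expectation (\<lambda>\<omega>. Z \<omega> * f \<omega>) = expectation (\<lambda>\<omega>. Z \<omega> * poisson_mixture (G n \<omega>) y)"
  shows "AE \<omega> in M. real_cond_exp M (F n) f \<omega> = poisson_mixture (G n \<omega>) y"
proof -
  interpret S: sigma_finite_subalgebra M "F n" by (rule F_sigma_finite)
  show ?thesis
  proof (rule S.real_cond_exp_charact[OF _ f _ poisson_mixture_measurable])
    show "integrable M (\<lambda>\<omega>. poisson_mixture (G n \<omega>) y)"
      using poisson_mixture_le_1[OF G_probs]
      by (intro integrable_bounded_real[where B = 1] measurable_F_M[OF poisson_mixture_measurable])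
    fix A assume "A \<in> sets (F n)"
    then show "(\<integral>\<omega>\<in>A. f \<omega> \<partial>M) = (\<integral>\<omega>\<in>A. poisson_mixture (G n \<omega>) y \<partial>M)"
      using eq[of "indicator A"] by (simp add: set_lebesgue_integral_def indicator_def)
  qed
qed

lemma integrable_indicator_Y: "n \<ge> 1 \<Longrightarrow> integrable M (\<lambda>\<omega>. indicator {y} (Y n \<omega>) :: real)"
  by (rule integrable_bounded_real[where B = 1, OF indicator_Y_measurable]) (auto simp: indicator_def)

lemma integrable_poisson_mixture_lim: "integrable M (\<lambda>\<omega>. poisson_mixture (G_lim \<omega>) y)"
  by (rule integrable_bounded_real[where B = 1, OF poisson_mixture_lim_measurable])
     (rule poisson_mixture_le_1[OF G_lim_probs])

theorem AE_cond_exp_future: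
  "AE \<omega> in M. \<forall>n k y. k \<ge> 1 \<longrightarrow>
    real_cond_exp M (F n) (\<lambda>\<omega>'. indicator {y} (Y (n + k) \<omega>')) \<omega>
      = real_cond_exp M (F n) (\<lambda>\<omega>'. poisson_mixture (G_lim \<omega>') y) \<omega>"
proof -
  have "AE \<omega> in M. k \<ge> 1 \<longrightarrow>
    real_cond_exp M (F n) (\<lambda>\<omega>'. indicator {y} (Y (n + k) \<omega>')) \<omega>
      = real_cond_exp M (F n) (\<lambda>\<omega>'. poisson_mixture (G_lim \<omega>') y) \<omega>" for n k y
  proof (cases "k \<ge> 1")
    case True
    have "AE \<omega> in M. real_cond_exp M (F n) (\<lambda>\<omega>'. indicator {y} (Y (n + k) \<omega>')) \<omega>
        = poisson_mixture (G n \<omega>) y"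
      using True by (intro real_cond_exp_eq_poisson_mixture integrable_indicator_Y expectation_indicator_future) auto
    moreover have "AE \<omega> in M. real_cond_exp M (F n) (\<lambda>\<omega>'. poisson_mixture (G_lim \<omega>') y) \<omega>
        = poisson_mixture (G n \<omega>) y"
      by (intro real_cond_exp_eq_poisson_mixture integrable_poisson_mixture_lim expectation_poisson_mixture_lim)
    ultimately show ?thesis
      by eventually_elim simp
  qed simp
  then show ?thesis
    by (simp add: AE_all_countable)
qed

theorem AE_empirical_frequency:
  "AE \<omega> in M. \<forall>y. (\<lambda>n. 1 / real n * (\<Sum>k=1..n. indicator {y} (Y k \<omega>)))
    \<longlonglongrightarrow> poisson_mixture (G_lim \<omega>) y"
proof (subst AE_all_countable, intro allI)
  fix y
  interpret E: bounded_martingale_difference M F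
    "\<lambda>n \<omega>. indicator {y} (Y (Suc n) \<omega>) - poisson_mixture (G n \<omega>) y" "\<lambda>n. 2"
    by (rule predictive_error_martingale_difference)
  show "AE \<omega> in M. (\<lambda>n. 1 / real n * (\<Sum>k=1..n. indicator {y} (Y k \<omega>)))
      \<longlonglongrightarrow> poisson_mixture (G_lim \<omega>) y"
    using E.AE_mean_tendsto_0[OF refl] AE_moments_converge
  proof eventually_elim
    case (elim \<omega>)
    \<comment> \<open>Each observation \<open>Y (Suc k)\<close> is compared with the prediction made
      from \<open>G k\<close>; the predictions average to the limit mixture.\<close>
    have "(\<lambda>n. (\<Sum>k<n. indicator {y} (Y (Suc k) \<omega>) - poisson_mixture (G k \<omega>) y) / real n
        + (\<Sum>k<n. poisson_mixture (G k \<omega>) y) / real n) \<longlonglongrightarrow> 0 + poisson_mixture (G_lim \<omega>) y"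
      by (intro tendsto_add elim(1) tendsto_cesaro_mean poisson_mixture_tendsto elim(2))
    then show ?case
      by (simp add: sum_subtractf diff_divide_distrib sum.atLeast1_atMost_eq)
  qed
qed

theorem prob_Y_eq:
  assumes "n \<ge> 1"
  shows "prob {\<omega> \<in> space M. Y n \<omega> = y} = expectation (\<lambda>\<omega>. poisson_mixture (G_lim \<omega>) y)"
proof -
  have "{\<omega> \<in> space M. Y n \<omega> = y} \<inter> space M = {\<omega> \<in> space M. Y n \<omega> = y}"
    by auto
  then have "prob {\<omega> \<in> space M. Y n \<omega> = y} = expectation (indicator {\<omega> \<in> space M. Y n \<omega> = y})"
    by simp
  \<comment> \<open>\<open>0 + n\<close> presents \<open>Y n\<close> as lying n steps after time 0,
    where the constant 1 is the test variable.\<close>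
  also have "\<dots> = expectation (\<lambda>\<omega>. 1 * indicator {y} (Y (0 + n) \<omega>))"
    by (intro Bochner_Integration.integral_cong) (auto simp: indicator_def)
  also have "\<dots> = expectation (\<lambda>\<omega>. 1 * poisson_mixture (G_lim \<omega>) y)"
    using expectation_indicator_future[of "\<lambda>_. 1" 0 1, OF _ _ assms] expectation_poisson_mixture_lim[of "\<lambda>_. 1" 0 1]
    by simp
  finally show ?thesis by simp
qed

end

theorem theorem2p1:
  fixes \<Theta> :: "real set" and G0 :: "real measure" and \<alpha> :: "nat \<Rightarrow> real"
    and M :: "'a measure" and Y :: "nat \<Rightarrow> 'a \<Rightarrow> nat"
  assumes "compact \<Theta>" and "\<Theta> \<subseteq> {0<..}"
    and "G0 \<in> space (prob_algebra (restrict_space borel \<Theta>))"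
    and "\<And>n. n \<ge> 1 \<Longrightarrow> 0 < \<alpha> n \<and> \<alpha> n < 1"
    and "filterlim (\<lambda>n. \<Sum>k=1..n. \<alpha> k) at_top sequentially"
    and "summable (\<lambda>n. (\<alpha> (Suc n))\<^sup>2)"
    and "prob_space M"
    and "\<And>n. n \<ge> 1 \<Longrightarrow> Y n \<in> measurable M (count_space UNIV)"
    and "\<And>n y. AE \<omega> in M.
           real_cond_exp M (nat_filtration M Y n) (\<lambda>\<omega>'. indicator {y} (Y (Suc n) \<omega>')) \<omega>
             = poisson_mixture (newton G0 \<alpha> (\<lambda>k. Y k \<omega>) n) y"
  shows "\<exists>G. G \<in> measurable M (prob_algebra (restrict_space borel \<Theta>)) \<and>
           (AE \<omega> in M. weak_conv_on \<Theta> (newton G0 \<alpha> (\<lambda>k. Y k \<omega>)) (G \<omega>)) \<and>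
           (AE \<omega> in M. \<forall>y. (\<lambda>n. 1 / real n * (\<Sum>k=1..n. indicator {y} (Y k \<omega>)))
                              \<longlonglongrightarrow> poisson_mixture (G \<omega>) y) \<and>
           (AE \<omega> in M. \<forall>n k y. k \<ge> 1 \<longrightarrow>
              real_cond_exp M (nat_filtration M Y n) (\<lambda>\<omega>'. indicator {y} (Y (n + k) \<omega>')) \<omega>
                = real_cond_exp M (nat_filtration M Y n) (\<lambda>\<omega>'. poisson_mixture (G \<omega>') y) \<omega>) \<and>
           (\<forall>n y. n \<ge> 1 \<longrightarrow>
              measure M {\<omega> \<in> space M. Y n \<omega> = y} = (\<integral>\<omega>. poisson_mixture (G \<omega>) y \<partial>M))"
proof -
  interpret newton_model \<Theta> M G0 \<alpha> Y
    using assms by (intro newton_model.intro compact_positive_support.intro newton_model_axioms.intro) auto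
  have "AE \<omega> in M. weak_conv_on \<Theta> (newton G0 \<alpha> (\<lambda>k. Y k \<omega>)) (G_lim \<omega>)"
    using AE_moments_converge
  proof eventually_elim
    case (elim \<omega>)
    then show ?case
      using G_lim_weak_limit(2)[OF elim] by (simp add: G_def)
  qed
  then show ?thesis
    using G_lim_measurable AE_empirical_frequency AE_cond_exp_future prob_Y_eq
    by (intro exI[of _ G_lim] conjI allI impI)
qed

end
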